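(* Suppose that the sequent $\Gamma ~|~ \gamma \vdash \phi$ is provable in the proof system described below. Then it is valid.
   Context: Variables are split into a countably infinite set of parameter variables $p_1, p_2, \ldots$ and the remaining team variables. $\mathrm{Free}_P(\phi)$ and $\mathrm{Free}_T(\phi)$ denote the free parameter variables and the free team variables of $\phi$. Independence logic formulas are in negation normal form. They are built from first-order literals and independence atoms $\bar t_2 \perp_{\bar t_1} \bar t_3$, where $\bar t_i$ are tuples of terms, using $\wedge$, $\vee$, $\exists x$ and $\forall x$. They contain no parameter variables. Entailment semantics. Let $M$ be a first-order structure, $\gamma$ a first-order formula, and $h$ a parameter assignment whose domain contains $\mathrm{Free}_P(\gamma)$. The relation $M \models_{\gamma(h)} \phi$ is defined as follows. (lit) $\phi$ is a literal and every assignment $s$ of team variables (with domain $\mathrm{Free}_T(\gamma)\cup\mathrm{Free}_T(\phi)$) such that $M\models_{h\cup s}\gamma$ satisfies $M\models_s\phi$. (ind) $\phi$ is $\bar t_2\perp_{\bar t_1}\bar t_3$, and for all such $s,s'$ with $M\models_{h\cup s}\gamma$, $M\models_{h\cup s'}\gamma$ and $\bar t_1\langle s\rangle=\bar t_1\langle s'\rangle$, there is $s''$ with $M\models_{h\cup s''}\gamma$, $\bar t_1\bar t_2\langle s''\rangle=\bar t_1\bar t_2\langle s\rangle$ and $\bar t_1\bar t_3\langle s''\rangle=\bar t_1\bar t_3\langle s'\rangle$. ($\vee$) $\phi=\psi_1\vee\psi_2$, and there are a parameter assignment $h'$ extending $h$ and first-order $\gamma_1,\gamma_2$ with parameters in $\mathrm{Dom}(h')$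 such that $M\models_{\gamma_1(h')}\psi_1$, $M\models_{\gamma_2(h')}\psi_2$ and $M\models_{h'}\forall\bar v(\gamma\leftrightarrow\gamma_1\vee\gamma_2)$. Here $\bar v$ lists the free team variables of $\gamma,\gamma_1,\gamma_2$. ($\wedge$) $M\models_{\gamma(h)}$ both conjuncts. ($\exists$) $\phi=\exists x\psi$, and there are $h'$ extending $h$ and a first-order $\gamma'$ with parameters in $\mathrm{Dom}(h')$ such that $M\models_{\gamma'(h')}\psi$ and $M\models_{h'}\forall\bar v(\exists x\gamma'\leftrightarrow\exists x\gamma)$. ($\forall$) $\phi=\forall x\psi$, and there are $h'$ extending $h$ and a first-order $\gamma'$ such that $M\models_{\gamma'(h')}\psi$ and $M\models_{h'}\forall\bar v(\gamma'\leftrightarrow\exists x\gamma)$. Sequents. A sequent $\Gamma ~|~ \gamma\vdash\phi$ consists of: - a finite set $\Gamma$ of first-order formulas whose free variables are parameter variables; - a first-order formula $\gamma$; - an independence logic formula $\phi$. The sequent is valid iff for every structure $M$ and every parameter assignment $h$ with domain $\mathrm{Free}_P(\Gamma)\cup\mathrm{Free}_P(\gamma)$ such that $M\models_h\Gamma$, we have $M\models_{\gamma(h)}\phi$. Proof system. In each axiom and rule, $\bar v$ denotes the relevant free team variables. Axioms: - PS-lit: $\forall\bar v(\gamma\to\phi) ~|~ \gamma\vdash\phi$, for a literal $\phi$ without parameter variables. - PS-ind: $\forall\bar v_1\bar v_2((\gamma(\bar v_1)\wedge\gamma(\bar v_2)\wedge\bar t_1(\bar v_1)=\bar t_1(\bar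 v_2))\to\exists\bar v_3(\gamma(\bar v_3)\wedge\bar t_1\bar t_2(\bar v_3)=\bar t_1\bar t_2(\bar v_1)\wedge\bar t_1\bar t_3(\bar v_3)=\bar t_1\bar t_3(\bar v_2))) ~|~ \gamma\vdash\bar t_2\perp_{\bar t_1}\bar t_3$, for terms without parameter variables. Rules: - PS-$\vee$: from $\Gamma_1~|~\gamma_1\vdash\phi_1$ and $\Gamma_2~|~\gamma_2\vdash\phi_2$ infer $\Gamma_1,\Gamma_2,\forall\bar v(\gamma\leftrightarrow\gamma_1\vee\gamma_2)~|~\gamma\vdash\phi_1\vee\phi_2$. - PS-$\wedge$: from $\Gamma_1~|~\gamma\vdash\phi_1$ and $\Gamma_2~|~\gamma\vdash\phi_2$ infer $\Gamma_1,\Gamma_2~|~\gamma\vdash\phi_1\wedge\phi_2$. - PS-$\exists$: from $\Gamma~|~\gamma'\vdash\phi$ infer $\Gamma,\forall\bar v(\exists x\gamma'\leftrightarrow\exists x\gamma)~|~\gamma\vdash\exists x\phi$, for a team variable $x$. - PS-$\forall$: from $\Gamma~|~\gamma'\vdash\phi$ infer $\Gamma,\forall\bar v(\gamma'\leftrightarrow\exists x\gamma)~|~\gamma\vdash\forall x\phi$, for a team variable $x$. - PS-ent: from $\Gamma~|~\gamma\vdash\phi$ and $\bigwedge\Gamma'\models\bigwedge\Gamma$ in first-order logic infer $\Gamma'~|~\gamma\vdash\phi$. - PS-depar: from $\Gamma~|~\gamma\vdash\phi$ infer $\exists p\bigwedge\Gamma~|~\gamma\vdash\phi$, for a parameter variable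 $p$ not free in $\gamma$. - PS-split: from $\Gamma_1~|~\gamma\vdash\phi$ and $\Gamma_2~|~\gamma\vdash\phi$ infer $(\bigwedge\Gamma_1)\vee(\bigwedge\Gamma_2)~|~\gamma\vdash\phi$. A proof is a finite list of sequents, each of which is an axiom or follows from earlier ones by one rule. *)

theory Defs
  imports Main
begin

section \<open>First-order logic with parameter and team variables\<close>

datatype var = Par nat | Team nat

datatype 'f trm = Var var | Fn 'f "'f trm list"

datatype ('f, 'r) atom = Rel 'r "'f trm list" | Equ "'f trm" "'f trm"

datatype ('f, 'r) fm =
    Atom "('f, 'r) atom"
  | Neg "('f, 'r) fm"
  | Con "('f, 'r) fm" "('f, 'r) fm"
  | Dis "('f, 'r) fm" "('f, 'r) fm"
  | Ex var "('f, 'r) fm"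
  | All var "('f, 'r) fm"

abbreviation Imp :: "('f, 'r) fm \<Rightarrow> ('f, 'r) fm \<Rightarrow> ('f, 'r) fm" where
  "Imp a b \<equiv> Dis (Neg a) b"

abbreviation Iff :: "('f, 'r) fm \<Rightarrow> ('f, 'r) fm \<Rightarrow> ('f, 'r) fm" where
  "Iff a b \<equiv> Con (Imp a b) (Imp b a)"

abbreviation Truth :: "('f, 'r) fm" where
  "Truth \<equiv> All (Par 0) (Atom (Equ (Var (Par 0)) (Var (Par 0))))"

fun conjs :: "('f, 'r) fm list \<Rightarrow> ('f, 'r) fm" where
  "conjs [] = Truth"
| "conjs [a] = a"
| "conjs (a # b # as) = Con a (conjs (b # as))"

text \<open>
  A signature assigns arities to the symbols it contains; a symbol mapped to \<open>None\<close> does not belong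
  to it. In this way every signature is covered, including those without function symbols.
\<close>

record ('f, 'r) signature =
  fun_arity :: "'f \<Rightarrow> nat option"
  rel_arity :: "'r \<Rightarrow> nat option"

fun wf_trm :: "('f, 'r) signature \<Rightarrow> 'f trm \<Rightarrow> bool" where
  "wf_trm \<sigma> (Var x) \<longleftrightarrow> True"
| "wf_trm \<sigma> (Fn f ts) \<longleftrightarrow> fun_arity \<sigma> f = Some (length ts) \<and> (\<forall>t \<in> set ts. wf_trm \<sigma> t)"

fun wf_atom :: "('f, 'r) signature \<Rightarrow> ('f, 'r) atom \<Rightarrow> bool" where
  "wf_atom \<sigma> (Rel r ts) \<longleftrightarrow> rel_arity \<sigma> r = Some (length ts) \<and> (\<forall>t \<in> set ts. wf_trm \<sigma> t)"
| "wf_atom \<sigma> (Equ t u) \<longleftrightarrow> wf_trm \<sigma> t \<and> wf_trm \<sigma> u"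

fun wf_fm :: "('f, 'r) signature \<Rightarrow> ('f, 'r) fm \<Rightarrow> bool" where
  "wf_fm \<sigma> (Atom a) \<longleftrightarrow> wf_atom \<sigma> a"
| "wf_fm \<sigma> (Neg a) \<longleftrightarrow> wf_fm \<sigma> a"
| "wf_fm \<sigma> (Con a b) \<longleftrightarrow> wf_fm \<sigma> a \<and> wf_fm \<sigma> b"
| "wf_fm \<sigma> (Dis a b) \<longleftrightarrow> wf_fm \<sigma> a \<and> wf_fm \<sigma> b"
| "wf_fm \<sigma> (Ex x a) \<longleftrightarrow> wf_fm \<sigma> a"
| "wf_fm \<sigma> (All x a) \<longleftrightarrow> wf_fm \<sigma> a"

fun trm_vars :: "'f trm \<Rightarrow> var set" where
  "trm_vars (Var x) = {x}"
| "trm_vars (Fn f ts) = (\<Union>t \<in> set ts. trm_vars t)"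

fun atom_vars :: "('f, 'r) atom \<Rightarrow> var set" where
  "atom_vars (Rel r ts) = (\<Union>t \<in> set ts. trm_vars t)"
| "atom_vars (Equ t u) = trm_vars t \<union> trm_vars u"

fun free_vars :: "('f, 'r) fm \<Rightarrow> var set" where
  "free_vars (Atom a) = atom_vars a"
| "free_vars (Neg a) = free_vars a"
| "free_vars (Con a b) = free_vars a \<union> free_vars b"
| "free_vars (Dis a b) = free_vars a \<union> free_vars b"
| "free_vars (Ex x a) = free_vars a - {x}"
| "free_vars (All x a) = free_vars a - {x}"

fun bound_vars :: "('f, 'r) fm \<Rightarrow> var set" where
  "bound_vars (Atom a) = {}"
| "bound_vars (Neg a) = bound_vars a"
| "bound_vars (Con a b) = bound_vars a \<union> bound_vars b"
| "bound_vars (Dis a b) = bound_vars a \<union> bound_vars b"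
| "bound_vars (Ex x a) = insert x (bound_vars a)"
| "bound_vars (All x a) = insert x (bound_vars a)"

definition FreeP :: "('f, 'r) fm \<Rightarrow> nat set" where
  "FreeP a = {p. Par p \<in> free_vars a}"

definition FreeT :: "('f, 'r) fm \<Rightarrow> nat set" where
  "FreeT a = {x. Team x \<in> free_vars a}"

definition FreeP_set :: "('f, 'r) fm set \<Rightarrow> nat set" where
  "FreeP_set \<Gamma> = (\<Union>a \<in> \<Gamma>. FreeP a)"

definition forallsT :: "nat list \<Rightarrow> ('f, 'r) fm \<Rightarrow> ('f, 'r) fm" where
  "forallsT xs a = foldr (\<lambda>x. All (Team x)) xs a"

definition existsT :: "nat list \<Rightarrow> ('f, 'r) fm \<Rightarrow> ('f, 'r) fm" where
  "existsT xs a = foldr (\<lambda>x. Ex (Team x)) xs a"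

text \<open>
  \<open>closeT a\<close> is \<open>\<forall>v. a\<close> with \<open>v\<close> listing the free team variables of \<open>a\<close>. The tuple is taken in increasing
  order; any other order gives an equivalent formula.
\<close>

definition closeT :: "('f, 'r) fm \<Rightarrow> ('f, 'r) fm" where
  "closeT a = forallsT (sorted_list_of_set (FreeT a)) a"

text \<open>
  Renaming of the free team variables. It does not avoid capture, and it is only used with targets
  that are not bound in the formula.
\<close>

fun ren_var :: "(nat \<Rightarrow> nat) \<Rightarrow> var \<Rightarrow> var" where
  "ren_var \<rho> (Par p) = Par p"
| "ren_var \<rho> (Team x) = Team (\<rho> x)"

fun ren_trm :: "(nat \<Rightarrow> nat) \<Rightarrow> 'f trm \<Rightarrow> 'f trm" where
  "ren_trm \<rho> (Var x) = Var (ren_var \<rho> x)"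
| "ren_trm \<rho> (Fn f ts) = Fn f (map (ren_trm \<rho>) ts)"

fun ren_atom :: "(nat \<Rightarrow> nat) \<Rightarrow> ('f, 'r) atom \<Rightarrow> ('f, 'r) atom" where
  "ren_atom \<rho> (Rel r ts) = Rel r (map (ren_trm \<rho>) ts)"
| "ren_atom \<rho> (Equ t u) = Equ (ren_trm \<rho> t) (ren_trm \<rho> u)"

fun ren_bind :: "(nat \<Rightarrow> nat) \<Rightarrow> var \<Rightarrow> (nat \<Rightarrow> nat)" where
  "ren_bind \<rho> (Par p) = \<rho>"
| "ren_bind \<rho> (Team x) = \<rho>(x := x)"

fun ren_fm :: "(nat \<Rightarrow> nat) \<Rightarrow> ('f, 'r) fm \<Rightarrow> ('f, 'r) fm" where
  "ren_fm \<rho> (Atom a) = Atom (ren_atom \<rho> a)"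
| "ren_fm \<rho> (Neg a) = Neg (ren_fm \<rho> a)"
| "ren_fm \<rho> (Con a b) = Con (ren_fm \<rho> a) (ren_fm \<rho> b)"
| "ren_fm \<rho> (Dis a b) = Dis (ren_fm \<rho> a) (ren_fm \<rho> b)"
| "ren_fm \<rho> (Ex x a) = Ex x (ren_fm (ren_bind \<rho> x) a)"
| "ren_fm \<rho> (All x a) = All x (ren_fm (ren_bind \<rho> x) a)"

definition tuple_eq :: "'f trm list \<Rightarrow> 'f trm list \<Rightarrow> ('f, 'r) fm" where
  "tuple_eq ts us = conjs (map2 (\<lambda>t u. Atom (Equ t u)) ts us)"

section \<open>Structures and first-order satisfaction\<close>

record ('f, 'r, 'u) struct =
  carr :: "'u set"
  fun_int :: "'f \<Rightarrow> 'u list \<Rightarrow> 'u"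
  rel_int :: "'r \<Rightarrow> 'u list \<Rightarrow> bool"

definition is_struct :: "('f, 'r) signature \<Rightarrow> ('f, 'r, 'u) struct \<Rightarrow> bool" where
  "is_struct \<sigma> M \<longleftrightarrow> carr M \<noteq> {} \<and>
     (\<forall>f as. fun_arity \<sigma> f = Some (length as) \<and> set as \<subseteq> carr M \<longrightarrow> fun_int M f as \<in> carr M)"

text \<open>
  Assignments are partial maps. An unassigned variable has the unspecified value \<open>the None\<close>, which is
  never consulted because the domains below contain the free variables of what is evaluated.
\<close>

fun trm_val :: "('f, 'r, 'u) struct \<Rightarrow> (var \<rightharpoonup> 'u) \<Rightarrow> 'f trm \<Rightarrow> 'u" where
  "trm_val M g (Var x) = the (g x)"
| "trm_val M g (Fn f ts) = fun_int M f (map (trm_val M g) ts)"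

fun atom_sat :: "('f, 'r, 'u) struct \<Rightarrow> (var \<rightharpoonup> 'u) \<Rightarrow> ('f, 'r) atom \<Rightarrow> bool" where
  "atom_sat M g (Rel r ts) \<longleftrightarrow> rel_int M r (map (trm_val M g) ts)"
| "atom_sat M g (Equ t u) \<longleftrightarrow> trm_val M g t = trm_val M g u"

fun sat :: "('f, 'r, 'u) struct \<Rightarrow> (var \<rightharpoonup> 'u) \<Rightarrow> ('f, 'r) fm \<Rightarrow> bool" where
  "sat M g (Atom a) \<longleftrightarrow> atom_sat M g a"
| "sat M g (Neg a) \<longleftrightarrow> \<not> sat M g a"
| "sat M g (Con a b) \<longleftrightarrow> sat M g a \<and> sat M g b"
| "sat M g (Dis a b) \<longleftrightarrow> sat M g a \<or> sat M g b"
| "sat M g (Ex x a) \<longleftrightarrow> (\<exists>u \<in> carr M. sat M (g(x \<mapsto> u)) a)"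
| "sat M g (All x a) \<longleftrightarrow> (\<forall>u \<in> carr M. sat M (g(x \<mapsto> u)) a)"

text \<open>The union of a parameter assignment \<open>h\<close> and a team-variable assignment \<open>s\<close>.\<close>

definition join :: "(nat \<rightharpoonup> 'u) \<Rightarrow> (nat \<rightharpoonup> 'u) \<Rightarrow> (var \<rightharpoonup> 'u)" where
  "join h s = (\<lambda>v. case v of Par p \<Rightarrow> h p | Team x \<Rightarrow> s x)"

definition sat_par :: "('f, 'r, 'u) struct \<Rightarrow> (nat \<rightharpoonup> 'u) \<Rightarrow> ('f, 'r) fm \<Rightarrow> bool" where
  "sat_par M h a \<longleftrightarrow> sat M (join h Map.empty) a"

text \<open>
  First-order entailment between finite sets of formulas without free team variables, over all
  structures whose carrier is a subset of the type \<open>'e\<close>. By the Loewenheim-Skolem theorem every infinite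
  type \<open>'e\<close> yields the usual notion, since only finitely many symbols are involved.
\<close>

definition entails ::
  "'e itself \<Rightarrow> ('f, 'r) signature \<Rightarrow> ('f, 'r) fm set \<Rightarrow> ('f, 'r) fm set \<Rightarrow> bool" where
  "entails E \<sigma> \<Gamma>' \<Gamma> \<longleftrightarrow>
     (\<forall>(M :: ('f, 'r, 'e) struct) h.
        is_struct \<sigma> M \<and> dom h = FreeP_set \<Gamma>' \<union> FreeP_set \<Gamma> \<and> ran h \<subseteq> carr M \<and>
        (\<forall>a \<in> \<Gamma>'. sat_par M h a) \<longrightarrow> (\<forall>a \<in> \<Gamma>. sat_par M h a))"

section \<open>Independence logic and its entailment semantics\<close>

datatype ('f, 'r) literal = PosLit "('f, 'r) atom" | NegLit "('f, 'r) atom"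

fun lit_fm :: "('f, 'r) literal \<Rightarrow> ('f, 'r) fm" where
  "lit_fm (PosLit a) = Atom a"
| "lit_fm (NegLit a) = Neg (Atom a)"

text \<open>\<open>Ind t1 t2 t3\<close> is the independence atom \<open>t2 \<bottom>\<^bsub>t1\<^esub> t3\<close>: the conditioning tuple comes first.\<close>

datatype ('f, 'r) ifm =
    Lit "('f, 'r) literal"
  | Ind "'f trm list" "'f trm list" "'f trm list"
  | IDis "('f, 'r) ifm" "('f, 'r) ifm"
  | ICon "('f, 'r) ifm" "('f, 'r) ifm"
  | IEx nat "('f, 'r) ifm"
  | IAll nat "('f, 'r) ifm"

fun ifree_vars :: "('f, 'r) ifm \<Rightarrow> var set" where
  "ifree_vars (Lit l) = free_vars (lit_fm l)"
| "ifree_vars (Ind t1 t2 t3) = (\<Union>t \<in> set (t1 @ t2 @ t3). trm_vars t)"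
| "ifree_vars (IDis \<phi> \<psi>) = ifree_vars \<phi> \<union> ifree_vars \<psi>"
| "ifree_vars (ICon \<phi> \<psi>) = ifree_vars \<phi> \<union> ifree_vars \<psi>"
| "ifree_vars (IEx x \<phi>) = ifree_vars \<phi> - {Team x}"
| "ifree_vars (IAll x \<phi>) = ifree_vars \<phi> - {Team x}"

definition IFreeT :: "('f, 'r) ifm \<Rightarrow> nat set" where
  "IFreeT \<phi> = {x. Team x \<in> ifree_vars \<phi>}"

text \<open>
  Independence logic formulas contain no parameter variables; bound variables are team variables by
  the type of the constructors, so it is enough to exclude free ones.
\<close>

fun wf_ifm_sig :: "('f, 'r) signature \<Rightarrow> ('f, 'r) ifm \<Rightarrow> bool" where
  "wf_ifm_sig \<sigma> (Lit l) \<longleftrightarrow> wf_fm \<sigma> (lit_fm l)"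
| "wf_ifm_sig \<sigma> (Ind t1 t2 t3) \<longleftrightarrow> (\<forall>t \<in> set (t1 @ t2 @ t3). wf_trm \<sigma> t)"
| "wf_ifm_sig \<sigma> (IDis \<phi> \<psi>) \<longleftrightarrow> wf_ifm_sig \<sigma> \<phi> \<and> wf_ifm_sig \<sigma> \<psi>"
| "wf_ifm_sig \<sigma> (ICon \<phi> \<psi>) \<longleftrightarrow> wf_ifm_sig \<sigma> \<phi> \<and> wf_ifm_sig \<sigma> \<psi>"
| "wf_ifm_sig \<sigma> (IEx x \<phi>) \<longleftrightarrow> wf_ifm_sig \<sigma> \<phi>"
| "wf_ifm_sig \<sigma> (IAll x \<phi>) \<longleftrightarrow> wf_ifm_sig \<sigma> \<phi>"

definition wf_ifm :: "('f, 'r) signature \<Rightarrow> ('f, 'r) ifm \<Rightarrow> bool" where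
  "wf_ifm \<sigma> \<phi> \<longleftrightarrow> wf_ifm_sig \<sigma> \<phi> \<and> ifree_vars \<phi> \<subseteq> range Team"

text \<open>\<open>in_team M h \<gamma> V s\<close>: \<open>s\<close> is an assignment with domain \<open>V\<close> such that \<open>h \<union> s\<close> satisfies \<open>\<gamma>\<close>.\<close>

definition in_team ::
  "('f, 'r, 'u) struct \<Rightarrow> (nat \<rightharpoonup> 'u) \<Rightarrow> ('f, 'r) fm \<Rightarrow> nat set \<Rightarrow> (nat \<rightharpoonup> 'u) \<Rightarrow> bool" where
  "in_team M h \<gamma> V s \<longleftrightarrow> dom s = V \<and> ran s \<subseteq> carr M \<and> sat M (join h s) \<gamma>"

definition tuple_val ::
  "('f, 'r, 'u) struct \<Rightarrow> (nat \<rightharpoonup> 'u) \<Rightarrow> 'f trm list \<Rightarrow> 'u list" where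
  "tuple_val M s ts = map (trm_val M (join Map.empty s)) ts"

text \<open>\<open>h'\<close> is a parameter assignment extending \<open>h\<close>.\<close>

definition par_ext ::
  "('f, 'r, 'u) struct \<Rightarrow> (nat \<rightharpoonup> 'u) \<Rightarrow> (nat \<rightharpoonup> 'u) \<Rightarrow> bool" where
  "par_ext M h h' \<longleftrightarrow> h \<subseteq>\<^sub>m h' \<and> ran h' \<subseteq> carr M"

definition fm_over ::
  "('f, 'r) signature \<Rightarrow> (nat \<rightharpoonup> 'u) \<Rightarrow> ('f, 'r) fm \<Rightarrow> bool" where
  "fm_over \<sigma> h \<gamma> \<longleftrightarrow> wf_fm \<sigma> \<gamma> \<and> FreeP \<gamma> \<subseteq> dom h"

text \<open>\<open>ent_sat \<sigma> M \<phi> \<gamma> h\<close> is the relation \<open>M \<Turnstile>\<^bsub>\<gamma>(h)\<^esub> \<phi>\<close>.\<close>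

fun ent_sat ::
  "('f, 'r) signature \<Rightarrow> ('f, 'r, 'u) struct \<Rightarrow> ('f, 'r) ifm \<Rightarrow> ('f, 'r) fm \<Rightarrow> (nat \<rightharpoonup> 'u) \<Rightarrow> bool"
where
  "ent_sat \<sigma> M (Lit l) \<gamma> h \<longleftrightarrow>
     (\<forall>s. in_team M h \<gamma> (FreeT \<gamma> \<union> IFreeT (Lit l)) s \<longrightarrow> sat M (join Map.empty s) (lit_fm l))"
| "ent_sat \<sigma> M (Ind t1 t2 t3) \<gamma> h \<longleftrightarrow>
     (let V = FreeT \<gamma> \<union> IFreeT (Ind t1 t2 t3 :: ('f, 'r) ifm) in
      \<forall>s s'. in_team M h \<gamma> V s \<and> in_team M h \<gamma> V s' \<and> tuple_val M s t1 = tuple_val M s' t1 \<longrightarrow>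
        (\<exists>s''. in_team M h \<gamma> V s'' \<and>
           tuple_val M s'' (t1 @ t2) = tuple_val M s (t1 @ t2) \<and>
           tuple_val M s'' (t1 @ t3) = tuple_val M s' (t1 @ t3)))"
| "ent_sat \<sigma> M (IDis \<psi>1 \<psi>2) \<gamma> h \<longleftrightarrow>
     (\<exists>h' \<gamma>1 \<gamma>2. par_ext M h h' \<and> fm_over \<sigma> h' \<gamma>1 \<and> fm_over \<sigma> h' \<gamma>2 \<and>
        ent_sat \<sigma> M \<psi>1 \<gamma>1 h' \<and> ent_sat \<sigma> M \<psi>2 \<gamma>2 h' \<and>
        sat_par M h' (closeT (Iff \<gamma> (Dis \<gamma>1 \<gamma>2))))"
| "ent_sat \<sigma> M (ICon \<psi>1 \<psi>2) \<gamma> h \<longleftrightarrow> ent_sat \<sigma> M \<psi>1 \<gamma> h \<and> ent_sat \<sigma> M \<psi>2 \<gamma> h"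
| "ent_sat \<sigma> M (IEx x \<psi>) \<gamma> h \<longleftrightarrow>
     (\<exists>h' \<gamma>'. par_ext M h h' \<and> fm_over \<sigma> h' \<gamma>' \<and> ent_sat \<sigma> M \<psi> \<gamma>' h' \<and>
        sat_par M h' (closeT (Iff (Ex (Team x) \<gamma>') (Ex (Team x) \<gamma>))))"
| "ent_sat \<sigma> M (IAll x \<psi>) \<gamma> h \<longleftrightarrow>
     (\<exists>h' \<gamma>'. par_ext M h h' \<and> fm_over \<sigma> h' \<gamma>' \<and> ent_sat \<sigma> M \<psi> \<gamma>' h' \<and>
        sat_par M h' (closeT (Iff \<gamma>' (Ex (Team x) \<gamma>))))"

section \<open>Sequents and validity\<close>

type_synonym ('f, 'r) sequent = "('f, 'r) fm set \<times> ('f, 'r) fm \<times> ('f, 'r) ifm"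

definition wf_ctx :: "('f, 'r) signature \<Rightarrow> ('f, 'r) fm set \<Rightarrow> bool" where
  "wf_ctx \<sigma> \<Gamma> \<longleftrightarrow> finite \<Gamma> \<and> (\<forall>a \<in> \<Gamma>. wf_fm \<sigma> a \<and> FreeT a = {})"

text \<open>
  The inference rules below require their new components to be well-formed, so every derivable sequent
  consists of a finite set of formulas without free team variables, a first-order formula and an
  independence logic formula without parameter variables, all over the signature.
\<close>

text \<open>Validity in all structures whose carrier is a subset of the type \<open>'u\<close>.\<close>

fun valid :: "'u itself \<Rightarrow> ('f, 'r) signature \<Rightarrow> ('f, 'r) sequent \<Rightarrow> bool" where
  "valid U \<sigma> (\<Gamma>, \<gamma>, \<phi>) \<longleftrightarrow>
     (\<forall>(M :: ('f, 'r, 'u) struct) h.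
        is_struct \<sigma> M \<and> dom h = FreeP_set \<Gamma> \<union> FreeP \<gamma> \<and> ran h \<subseteq> carr M \<and>
        (\<forall>a \<in> \<Gamma>. sat_par M h a) \<longrightarrow> ent_sat \<sigma> M \<phi> \<gamma> h)"

section \<open>The proof system\<close>

text \<open>
  The premise of \<open>PS-ind\<close>. The tuple \<open>v\<close> lists the free team variables of \<open>\<gamma>\<close> and of the atom, and its
  copies \<open>v1\<close>, \<open>v2\<close>, \<open>v3\<close> are given by three renamings.
\<close>

definition ind_vars :: "('f, 'r) fm \<Rightarrow> 'f trm list \<Rightarrow> 'f trm list \<Rightarrow> 'f trm list \<Rightarrow> nat set" where
  "ind_vars \<gamma> t1 t2 t3 = FreeT \<gamma> \<union> {x. Team x \<in> (\<Union>t \<in> set (t1 @ t2 @ t3). trm_vars t)}"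

definition fresh_copies ::
  "nat set \<Rightarrow> ('f, 'r) fm \<Rightarrow> (nat \<Rightarrow> nat) \<Rightarrow> (nat \<Rightarrow> nat) \<Rightarrow> (nat \<Rightarrow> nat) \<Rightarrow> bool" where
  "fresh_copies V \<gamma> \<rho>1 \<rho>2 \<rho>3 \<longleftrightarrow>
     inj_on \<rho>1 V \<and> inj_on \<rho>2 V \<and> inj_on \<rho>3 V \<and>
     \<rho>1 ` V \<inter> \<rho>2 ` V = {} \<and> \<rho>1 ` V \<inter> \<rho>3 ` V = {} \<and> \<rho>2 ` V \<inter> \<rho>3 ` V = {} \<and>
     (\<rho>1 ` V \<union> \<rho>2 ` V \<union> \<rho>3 ` V) \<inter> (V \<union> {x. Team x \<in> bound_vars \<gamma>}) = {}"

definition ind_fm ::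
  "(nat \<Rightarrow> nat) \<Rightarrow> (nat \<Rightarrow> nat) \<Rightarrow> (nat \<Rightarrow> nat) \<Rightarrow>
   ('f, 'r) fm \<Rightarrow> 'f trm list \<Rightarrow> 'f trm list \<Rightarrow> 'f trm list \<Rightarrow> ('f, 'r) fm" where
  "ind_fm \<rho>1 \<rho>2 \<rho>3 \<gamma> t1 t2 t3 =
     (let v = sorted_list_of_set (ind_vars \<gamma> t1 t2 t3); at = (\<lambda>\<rho>. map (ren_trm \<rho>)) in
      forallsT (map \<rho>1 v @ map \<rho>2 v)
        (Imp (Con (ren_fm \<rho>1 \<gamma>) (Con (ren_fm \<rho>2 \<gamma>) (tuple_eq (at \<rho>1 t1) (at \<rho>2 t1))))
          (existsT (map \<rho>3 v)
            (Con (ren_fm \<rho>3 \<gamma>)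
              (Con (tuple_eq (at \<rho>3 (t1 @ t2)) (at \<rho>1 (t1 @ t2)))
                   (tuple_eq (at \<rho>3 (t1 @ t3)) (at \<rho>2 (t1 @ t3))))))))"

text \<open>
  \<open>infer E \<sigma> Ss S\<close>: the sequent \<open>S\<close> follows from the sequents \<open>Ss\<close> by one rule, where axioms are rules
  without premises. The type \<open>'e\<close> is the one over which the first-order entailment of \<open>PS-ent\<close> is
  understood. The conjunction of a finite set of formulas may be formed along any enumeration of it.
\<close>

inductive infer ::
  "'e itself \<Rightarrow> ('f, 'r) signature \<Rightarrow> ('f, 'r) sequent list \<Rightarrow> ('f, 'r) sequent \<Rightarrow> bool"
  for E :: "'e itself" and \<sigma> :: "('f, 'r) signature"
where
  PS_lit: "wf_fm \<sigma> \<gamma> \<Longrightarrow> wf_ifm \<sigma> (Lit l) \<Longrightarrow>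
    infer E \<sigma> [] ({closeT (Imp \<gamma> (lit_fm l))}, \<gamma>, Lit l)"
| PS_ind: "wf_fm \<sigma> \<gamma> \<Longrightarrow> wf_ifm \<sigma> (Ind t1 t2 t3) \<Longrightarrow>
    fresh_copies (ind_vars \<gamma> t1 t2 t3) \<gamma> \<rho>1 \<rho>2 \<rho>3 \<Longrightarrow>
    infer E \<sigma> [] ({ind_fm \<rho>1 \<rho>2 \<rho>3 \<gamma> t1 t2 t3}, \<gamma>, Ind t1 t2 t3)"
| PS_dis: "wf_fm \<sigma> \<gamma> \<Longrightarrow>
    infer E \<sigma> [(\<Gamma>1, \<gamma>1, \<phi>1), (\<Gamma>2, \<gamma>2, \<phi>2)]
      (\<Gamma>1 \<union> \<Gamma>2 \<union> {closeT (Iff \<gamma> (Dis \<gamma>1 \<gamma>2))}, \<gamma>, IDis \<phi>1 \<phi>2)"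
| PS_con: "infer E \<sigma> [(\<Gamma>1, \<gamma>, \<phi>1), (\<Gamma>2, \<gamma>, \<phi>2)] (\<Gamma>1 \<union> \<Gamma>2, \<gamma>, ICon \<phi>1 \<phi>2)"
| PS_ex: "wf_fm \<sigma> \<gamma> \<Longrightarrow>
    infer E \<sigma> [(\<Gamma>, \<gamma>', \<phi>)]
      (\<Gamma> \<union> {closeT (Iff (Ex (Team x) \<gamma>') (Ex (Team x) \<gamma>))}, \<gamma>, IEx x \<phi>)"
| PS_all: "wf_fm \<sigma> \<gamma> \<Longrightarrow>
    infer E \<sigma> [(\<Gamma>, \<gamma>', \<phi>)]
      (\<Gamma> \<union> {closeT (Iff \<gamma>' (Ex (Team x) \<gamma>))}, \<gamma>, IAll x \<phi>)"
| PS_ent: "wf_ctx \<sigma> \<Gamma>' \<Longrightarrow> entails E \<sigma> \<Gamma>' \<Gamma> \<Longrightarrow>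
    infer E \<sigma> [(\<Gamma>, \<gamma>, \<phi>)] (\<Gamma>', \<gamma>, \<phi>)"
| PS_depar: "p \<notin> FreeP \<gamma> \<Longrightarrow> set gs = \<Gamma> \<Longrightarrow> distinct gs \<Longrightarrow>
    infer E \<sigma> [(\<Gamma>, \<gamma>, \<phi>)] ({Ex (Par p) (conjs gs)}, \<gamma>, \<phi>)"
| PS_split: "set gs1 = \<Gamma>1 \<Longrightarrow> distinct gs1 \<Longrightarrow> set gs2 = \<Gamma>2 \<Longrightarrow> distinct gs2 \<Longrightarrow>
    infer E \<sigma> [(\<Gamma>1, \<gamma>, \<phi>), (\<Gamma>2, \<gamma>, \<phi>)] ({Dis (conjs gs1) (conjs gs2)}, \<gamma>, \<phi>)"

definition is_proof ::
  "'e itself \<Rightarrow> ('f, 'r) signature \<Rightarrow> ('f, 'r) sequent list \<Rightarrow> bool" where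
  "is_proof E \<sigma> Ss \<longleftrightarrow>
     (\<forall>i < length Ss. \<exists>prems. set prems \<subseteq> set (take i Ss) \<and> infer E \<sigma> prems (Ss ! i))"

definition provable :: "'e itself \<Rightarrow> ('f, 'r) signature \<Rightarrow> ('f, 'r) sequent \<Rightarrow> bool" where
  "provable E \<sigma> S \<longleftrightarrow> (\<exists>Ss. is_proof E \<sigma> Ss \<and> Ss \<noteq> [] \<and> last Ss = S)"

end

(*
  Validity is proved, by induction on the proof, for all parameter assignments whose finite domain
  contains the parameters of the sequent: exact domains are not inherited by premises. The rules that
  change parameters (PS-depar, PS-ent) then need that M |=_{gamma(h)} phi depends only on the team
  that gamma defines over h. This holds for finite domains, because the parameters of the witnessing
  formulas can be shifted away from dom h. PS-ent refers to entailment over structures inside a fixed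
  infinite type, which is transferred to an arbitrary structure by a countable Skolem hull.
*)

theory Submission
  imports Defs "HOL-Library.Countable_Set"
begin

section \<open>Satisfaction and free variables\<close>

text \<open>Two features of the semantics shape the proof. First, PS-depar may have to overwrite a
  value: \<open>p\<close> is not free in \<open>\<gamma>\<close>, but it may lie in the domain of
  \<open>h\<close> once larger domains are allowed. The premise then yields witnesses over
  extensions of the modified assignment and not of \<open>h\<close>, so they cannot simply be
  reused; they are rebuilt over \<open>h\<close> with new parameter names. Second, the domain of the
  team assignments, \<open>FreeT \<gamma> \<union> IFreeT \<phi>\<close>, depends on how
  \<open>\<gamma>\<close> is written, so two formulas that define the same team may be tested on
  assignments with different domains. Total team assignments serve as a common ground, at the price
  of default values taken from the nonempty carrier.\<close>

lemma join_simps [simp]: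
  "join h s (Par p) = h p"
  "join h s (Team x) = s x"
  by (simp_all add: join_def)

lemma finite_trm_vars: "finite (trm_vars t)"
  by (induction t) auto

lemma finite_free_vars: "finite (free_vars a)"
proof (induction a)
  case (Atom a)
  then show ?case by (cases a) (auto simp: finite_trm_vars)
qed auto

lemma finite_FreeT: "finite (FreeT a)"
proof -
  have "FreeT a = Team -` free_vars a" by (auto simp: FreeT_def)
  then show ?thesis by (simp add: finite_vimageI finite_free_vars inj_def)
qed

lemma finite_FreeP: "finite (FreeP a)"
proof -
  have "FreeP a = Par -` free_vars a" by (auto simp: FreeP_def)
  then show ?thesis by (simp add: finite_vimageI finite_free_vars inj_def)
qed

lemma trm_val_cong:
  "(\<And>v. v \<in> trm_vars t \<Longrightarrow> g v = g' v) \<Longrightarrow> trm_val M g t = trm_val M g' t"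
proof (induction t)
  case (Fn f ts)
  then have "map (trm_val M g) ts = map (trm_val M g') ts" by fastforce
  then show ?case by (metis trm_val.simps(2))
qed simp

lemma atom_sat_cong:
  assumes "\<And>v. v \<in> atom_vars a \<Longrightarrow> g v = g' v"
  shows "atom_sat M g a = atom_sat M g' a"
proof (cases a)
  case (Rel r ts)
  then have "map (trm_val M g) ts = map (trm_val M g') ts"
    using assms by (auto intro: trm_val_cong)
  then show ?thesis using Rel by (metis atom_sat.simps(1))
next
  case (Equ t u)
  then show ?thesis using assms trm_val_cong[of t g g' M] trm_val_cong[of u g g' M] by auto
qed

lemma sat_cong:
  "(\<And>v. v \<in> free_vars a \<Longrightarrow> g v = g' v) \<Longrightarrow> sat M g a = sat M g' a"
proof (induction a arbitrary: g g')
  case (Atom a)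
  then show ?case using atom_sat_cong[of a g g' M] by simp
next
  case (Neg a)
  have "sat M g a = sat M g' a" by (rule Neg.IH) (simp add: Neg.prems)
  then show ?case by simp
next
  case (Con a b)
  have "sat M g a = sat M g' a" by (rule Con.IH(1)) (simp add: Con.prems)
  moreover have "sat M g b = sat M g' b" by (rule Con.IH(2)) (simp add: Con.prems)
  ultimately show ?case by simp
next
  case (Dis a b)
  have "sat M g a = sat M g' a" by (rule Dis.IH(1)) (simp add: Dis.prems)
  moreover have "sat M g b = sat M g' b" by (rule Dis.IH(2)) (simp add: Dis.prems)
  ultimately show ?case by simp
next
  case (Ex x a)
  have "sat M (g(x \<mapsto> u)) a = sat M (g'(x \<mapsto> u)) a" for u
    by (rule Ex.IH) (simp add: Ex.prems)
  then show ?case by (simp only: sat.simps)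
next
  case (All x a)
  have "sat M (g(x \<mapsto> u)) a = sat M (g'(x \<mapsto> u)) a" for u
    by (rule All.IH) (simp add: All.prems)
  then show ?case by (simp only: sat.simps)
qed

lemma sat_par_cong:
  assumes "\<And>p. p \<in> FreeP a \<Longrightarrow> h p = h' p"
  shows "sat_par M h a = sat_par M h' a"
  unfolding sat_par_def
proof (rule sat_cong)
  fix v assume "v \<in> free_vars a"
  then show "join h Map.empty v = join h' Map.empty v"
    using assms by (cases v) (auto simp: FreeP_def)
qed

lemma sat_join_cong:
  assumes "\<And>p. p \<in> FreeP a \<Longrightarrow> h p = h' p"
  shows "sat M (join h s) a = sat M (join h' s) a"
proof (rule sat_cong)
  fix v assume "v \<in> free_vars a"
  then show "join h s v = join h' s v"
    using assms by (cases v) (auto simp: FreeP_def)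
qed

lemma sat_conjs: "sat M g (conjs as) \<longleftrightarrow> (\<forall>a \<in> set as. sat M g a)"
  by (induction as rule: conjs.induct) auto

lemma free_vars_conjs: "free_vars (conjs as) = (\<Union>a \<in> set as. free_vars a)"
  by (induction as rule: conjs.induct) auto

lemma wf_conjs: "(\<forall>a \<in> set as. wf_fm \<sigma> a) \<Longrightarrow> wf_fm \<sigma> (conjs as)"
  by (induction as rule: conjs.induct) auto

lemma sat_tuple_eq:
  assumes "length ts = length us"
  shows "sat M g (tuple_eq ts us) \<longleftrightarrow> map (trm_val M g) ts = map (trm_val M g) us"
  using assms by (induction ts us rule: list_induct2) (auto simp: tuple_eq_def sat_conjs)

lemma free_vars_tuple_eq:
  "free_vars (tuple_eq ts us) \<subseteq> (\<Union>t \<in> set ts \<union> set us. trm_vars t)"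
  by (auto simp: tuple_eq_def free_vars_conjs elim!: in_set_zipE)

lemma wf_tuple_eq:
  "(\<forall>t \<in> set ts \<union> set us. wf_trm \<sigma> t) \<Longrightarrow> wf_fm \<sigma> (tuple_eq ts us)"
  unfolding tuple_eq_def
  by (rule wf_conjs) (auto elim!: in_set_zipE)

section \<open>Blocks of team quantifiers\<close>

text \<open>Values are indexed by variables and not by positions in a list, so a block of
  quantifiers with repeated variables needs no separate treatment.\<close>

definition team_upd :: "(var \<rightharpoonup> 'u) \<Rightarrow> nat set \<Rightarrow> (nat \<Rightarrow> 'u) \<Rightarrow> (var \<rightharpoonup> 'u)" where
  "team_upd g X u = (\<lambda>v. case v of Par p \<Rightarrow> g v | Team x \<Rightarrow> if x \<in> X then Some (u x) else g v)"

lemma team_upd_simps [simp]: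
  "team_upd g X u (Par p) = g (Par p)"
  "team_upd g X u (Team x) = (if x \<in> X then Some (u x) else g (Team x))"
  by (simp_all add: team_upd_def)

lemma forallsT_Cons: "forallsT (x # xs) a = All (Team x) (forallsT xs a)"
  by (simp add: forallsT_def)

lemma sat_forallsT:
  "sat M g (forallsT xs a) \<longleftrightarrow>
     (\<forall>u. (\<forall>x \<in> set xs. u x \<in> carr M) \<longrightarrow> sat M (team_upd g (set xs) u) a)"
proof (induction xs arbitrary: g)
  case Nil
  have "team_upd g {} u = g" for u by (rule ext) (simp add: team_upd_def split: var.split)
  then show ?case by (simp add: forallsT_def)
next
  case (Cons y xs)
  have 1: "team_upd (g(Team y \<mapsto> u y)) (set xs) u = team_upd g (set (y # xs)) u" for u
    by (rule ext) (auto simp: team_upd_def split: var.split)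
  \<comment> \<open>If \<open>y\<close> recurs in \<open>xs\<close>, an inner quantifier overrides
    \<open>c\<close>; otherwise \<open>c\<close> becomes the value of the new function at
    \<open>y\<close>.\<close>
  have 2: "team_upd (g(Team y \<mapsto> c)) (set xs) u =
      team_upd g (set (y # xs)) (if y \<in> set xs then u else u(y := c))" for u c
    by (rule ext) (auto simp: team_upd_def split: var.split)
  have "sat M g (forallsT (y # xs) a) \<longleftrightarrow>
    (\<forall>c \<in> carr M. \<forall>u. (\<forall>x \<in> set xs. u x \<in> carr M) \<longrightarrow>
       sat M (team_upd (g(Team y \<mapsto> c)) (set xs) u) a)"
    by (simp only: forallsT_Cons sat.simps Cons)
  also have "\<dots> \<longleftrightarrow> (\<forall>u. (\<forall>x \<in> set (y # xs). u x \<in> carr M) \<longrightarrow>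
      sat M (team_upd g (set (y # xs)) u) a)" (is "?L \<longleftrightarrow> ?R")
  proof
    assume ?L
    then show ?R using 1 by (metis list.set_intros)
  next
    assume R: ?R
    show ?L
    proof (intro ballI allI impI)
      fix c u assume "c \<in> carr M" "\<forall>x \<in> set xs. u x \<in> carr M"
      then have "\<forall>x \<in> set (y # xs). (if y \<in> set xs then u else u(y := c)) x \<in> carr M" by auto
      then show "sat M (team_upd (g(Team y \<mapsto> c)) (set xs) u) a" using R unfolding 2 by blast
    qed
  qed
  finally show ?case .
qed

lemma sat_existsT:
  "sat M g (existsT xs a) \<longleftrightarrow>
     (\<exists>u. (\<forall>x \<in> set xs. u x \<in> carr M) \<and> sat M (team_upd g (set xs) u) a)"
proof -
  have "sat M g (existsT xs a) \<longleftrightarrow> \<not> sat M g (forallsT xs (Neg a))"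
    by (induction xs arbitrary: g) (auto simp: existsT_def forallsT_def)
  then show ?thesis by (auto simp: sat_forallsT)
qed

lemma free_vars_forallsT: "free_vars (forallsT xs a) = free_vars a - Team ` set xs"
  by (induction xs) (auto simp: forallsT_def)

lemma free_vars_existsT: "free_vars (existsT xs a) = free_vars a - Team ` set xs"
  by (induction xs) (auto simp: existsT_def)

lemma wf_forallsT: "wf_fm \<sigma> (forallsT xs a) = wf_fm \<sigma> a"
  by (induction xs) (auto simp: forallsT_def)

lemma wf_existsT: "wf_fm \<sigma> (existsT xs a) = wf_fm \<sigma> a"
  by (induction xs) (auto simp: existsT_def)

lemma free_vars_closeT: "free_vars (closeT a) = free_vars a - range Team"
proof -
  have "set (sorted_list_of_set (FreeT a)) = FreeT a" by (simp add: finite_FreeT)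
  then show ?thesis unfolding closeT_def free_vars_forallsT by (auto simp: FreeT_def)
qed

lemma FreeP_closeT: "FreeP (closeT a) = FreeP a"
  by (auto simp: FreeP_def free_vars_closeT)

lemma FreeT_closeT: "FreeT (closeT a) = {}"
  by (auto simp: FreeT_def free_vars_closeT)

lemma wf_closeT: "wf_fm \<sigma> (closeT a) = wf_fm \<sigma> a"
  by (simp add: closeT_def wf_forallsT)

section \<open>Total team assignments\<close>

text \<open>One space of assignments for all formulas: unlike the domains in \<open>in_team\<close>
  it does not vary with \<open>\<gamma>\<close>, and it is closed under the updates made by team
  quantifiers.\<close>

definition tot :: "(nat \<rightharpoonup> 'u) \<Rightarrow> (nat \<Rightarrow> 'u) \<Rightarrow> (var \<rightharpoonup> 'u)" where
  "tot h u = join h (\<lambda>x. Some (u x))"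

lemma tot_simps [simp]:
  "tot h u (Par p) = h p"
  "tot h u (Team x) = Some (u x)"
  by (simp_all add: tot_def)

lemma tot_upd: "(tot h u)(Team x \<mapsto> c) = tot h (u(x := c))"
proof
  fix v
  show "((tot h u)(Team x \<mapsto> c)) v = tot h (u(x := c)) v" by (cases v) auto
qed

lemma sat_tot_cong:
  assumes "\<And>p. p \<in> FreeP a \<Longrightarrow> h p = h' p"
  shows "sat M (tot h u) a = sat M (tot h' u) a"
  unfolding tot_def using assms by (rule sat_join_cong)

lemma sat_tot_par_ext:
  assumes "par_ext M h h'" "FreeP a \<subseteq> dom h"
  shows "sat M (tot h' u) a = sat M (tot h u) a"
proof (rule sat_tot_cong)
  fix p assume "p \<in> FreeP a"
  then have "p \<in> dom h" using assms(2) by blast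
  then show "h' p = h p" using assms(1) by (simp add: par_ext_def map_le_def)
qed

text \<open>Variables that are not free may take any value, and the carrier has one to offer. Hence
  all closures quantify over the same set of assignments, whatever tuple of variables each formula
  lists.\<close>

lemma sat_closeT:
  assumes "carr M \<noteq> {}"
  shows "sat_par M h (closeT a) \<longleftrightarrow> (\<forall>u. range u \<subseteq> carr M \<longrightarrow> sat M (tot h u) a)"
proof -
  have eq: "sat M (team_upd (join h Map.empty) (FreeT a) u) a = sat M (tot h u') a"
    if "\<And>x. x \<in> FreeT a \<Longrightarrow> u x = u' x" for u u'
  proof (rule sat_cong)
    fix v assume "v \<in> free_vars a"
    then show "team_upd (join h Map.empty) (FreeT a) u v = tot h u' v"
      using that by (cases v) (auto simp: FreeT_def)
  qed
  obtain c where c: "c \<in> carr M" using assms by auto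
  have "sat_par M h (closeT a) \<longleftrightarrow> (\<forall>u. (\<forall>x \<in> FreeT a. u x \<in> carr M) \<longrightarrow>
     sat M (team_upd (join h Map.empty) (FreeT a) u) a)"
    by (simp add: sat_par_def closeT_def sat_forallsT finite_FreeT)
  also have "\<dots> \<longleftrightarrow> (\<forall>u. range u \<subseteq> carr M \<longrightarrow> sat M (tot h u) a)" (is "?L \<longleftrightarrow> ?R")
  proof
    assume ?L
    then show ?R using eq by blast
  next
    assume R: ?R
    show ?L
    proof (intro allI impI)
      fix u assume u: "\<forall>x \<in> FreeT a. u x \<in> carr M"
      let ?u = "\<lambda>x. if x \<in> FreeT a then u x else c"
      have "range ?u \<subseteq> carr M" using u c by auto
      then have "sat M (tot h ?u) a" using R by blast
      then show "sat M (team_upd (join h Map.empty) (FreeT a) u) a"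
        using eq[of u ?u] by simp
    qed
  qed
  finally show ?thesis .
qed

definition restr :: "nat set \<Rightarrow> (nat \<Rightarrow> 'u) \<Rightarrow> (nat \<rightharpoonup> 'u)" where
  "restr V u = (\<lambda>x. if x \<in> V then Some (u x) else None)"

lemma sat_join_restr:
  assumes "FreeT \<gamma> \<subseteq> V"
  shows "sat M (join h (restr V u)) \<gamma> = sat M (tot h u) \<gamma>"
proof (rule sat_cong)
  fix v assume "v \<in> free_vars \<gamma>"
  then show "join h (restr V u) v = tot h u v"
    using assms by (cases v) (auto simp: FreeT_def restr_def)
qed

lemma in_team_restrI:
  assumes "FreeT \<gamma> \<subseteq> V" "range u \<subseteq> carr M" "sat M (tot h u) \<gamma>"
  shows "in_team M h \<gamma> V (restr V u)"
proof -
  have "dom (restr V u) = V" by (auto simp: restr_def dom_def)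
  moreover have "ran (restr V u) \<subseteq> carr M" using assms(2) by (auto simp: restr_def ran_def)
  ultimately show ?thesis using assms by (simp add: in_team_def sat_join_restr)
qed

lemma in_team_restrE:
  assumes "FreeT \<gamma> \<subseteq> V" "carr M \<noteq> {}" "in_team M h \<gamma> V s"
  obtains u where "range u \<subseteq> carr M" "s = restr V u" "sat M (tot h u) \<gamma>"
proof -
  obtain c where c: "c \<in> carr M" using assms by auto
  \<comment> \<open>The default \<open>c\<close> is invisible to \<open>\<gamma>\<close>, whose free
    team variables all lie in \<open>V\<close>.\<close>
  define u where "u = (\<lambda>x. case s x of None \<Rightarrow> c | Some y \<Rightarrow> y)"
  have s: "s = restr V u"
  proof
    fix x
    show "s x = restr V u x"
      using assms(3) by (cases "s x") (auto simp: in_team_def restr_def u_def)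
  qed
  have "range u \<subseteq> carr M"
  proof (intro image_subsetI)
    fix x
    show "u x \<in> carr M"
      using assms(3) c by (cases "s x") (auto simp: in_team_def u_def intro: ranI)
  qed
  moreover have "sat M (tot h u) \<gamma>"
    using assms(3) unfolding s in_team_def sat_join_restr[OF assms(1)] by simp
  ultimately show ?thesis using s that by simp
qed

section \<open>Literals and independence atoms over total assignments\<close>

lemma ent_sat_Lit_iff:
  assumes "carr M \<noteq> {}"
  shows "ent_sat \<sigma> M (Lit l) \<gamma> h \<longleftrightarrow>
    (\<forall>u. range u \<subseteq> carr M \<and> sat M (tot h u) \<gamma> \<longrightarrow> sat M (tot Map.empty u) (lit_fm l))"
proof -
  define V where "V = FreeT \<gamma> \<union> IFreeT (Lit l)"
  have V: "FreeT \<gamma> \<subseteq> V" by (simp add: V_def)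
  have "FreeT (lit_fm l) \<subseteq> V" by (auto simp: V_def FreeT_def IFreeT_def)
  note eq = sat_join_restr[OF this]
  show ?thesis
    unfolding ent_sat.simps V_def[symmetric]
  proof (intro iffI allI impI)
    fix u
    assume L: "\<forall>s. in_team M h \<gamma> V s \<longrightarrow> sat M (join Map.empty s) (lit_fm l)"
      and u: "range u \<subseteq> carr M \<and> sat M (tot h u) \<gamma>"
    have "in_team M h \<gamma> V (restr V u)" by (rule in_team_restrI[OF V]) (simp_all add: u)
    then have "sat M (join Map.empty (restr V u)) (lit_fm l)" using L by blast
    then show "sat M (tot Map.empty u) (lit_fm l)" by (simp only: eq)
  next
    fix s
    assume R: "\<forall>u. range u \<subseteq> carr M \<and> sat M (tot h u) \<gamma> \<longrightarrow> sat M (tot Map.empty u) (lit_fm l)"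
      and s: "in_team M h \<gamma> V s"
    obtain u where "range u \<subseteq> carr M" "s = restr V u" "sat M (tot h u) \<gamma>"
      using in_team_restrE[OF V assms s] by metis
    then show "sat M (join Map.empty s) (lit_fm l)" using R by (simp add: eq)
  qed
qed

text \<open>The clause for independence atoms, for the team \<open>X\<close> seen as a set of total assignments.\<close>

definition ind_team ::
  "('f, 'r, 'u) struct \<Rightarrow> (nat \<Rightarrow> 'u) set \<Rightarrow> 'f trm list \<Rightarrow> 'f trm list \<Rightarrow> 'f trm list \<Rightarrow> bool" where
  "ind_team M X t1 t2 t3 \<longleftrightarrow>
    (let val = (\<lambda>u. map (trm_val M (tot Map.empty u))) in
     \<forall>u \<in> X. \<forall>u' \<in> X. val u t1 = val u' t1 \<longrightarrow>
       (\<exists>u'' \<in> X. val u'' (t1 @ t2) = val u (t1 @ t2) \<and> val u'' (t1 @ t3) = val u' (t1 @ t3)))"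

definition team :: "('f, 'r, 'u) struct \<Rightarrow> (nat \<rightharpoonup> 'u) \<Rightarrow> ('f, 'r) fm \<Rightarrow> (nat \<Rightarrow> 'u) set" where
  "team M h \<gamma> = {u. range u \<subseteq> carr M \<and> sat M (tot h u) \<gamma>}"

text \<open>\<open>restr V\<close> maps the total team onto the partial one and keeps the values of
  the tuples, because \<open>V\<close> contains their team variables. Along this surjection all
  three quantifiers of the clause move from partial to total assignments.\<close>

lemma ent_sat_Ind_iff:
  fixes \<sigma> :: "('f, 'r) signature" and M :: "('f, 'r, 'u) struct"
  assumes "carr M \<noteq> {}"
  shows "ent_sat \<sigma> M (Ind t1 t2 t3) \<gamma> h \<longleftrightarrow> ind_team M (team M h \<gamma>) t1 t2 t3"
proof -
  define V where "V = FreeT \<gamma> \<union> IFreeT (Ind t1 t2 t3 :: ('f, 'r) ifm)"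
  have V: "FreeT \<gamma> \<subseteq> V" by (simp add: V_def)
  have tv: "tuple_val M (restr V u) ts = map (trm_val M (tot Map.empty u)) ts"
    if "set ts \<subseteq> set (t1 @ t2 @ t3)" for u ts
    unfolding tuple_val_def
  proof (rule map_cong[OF refl], rule trm_val_cong)
    fix t v assume "t \<in> set ts" "v \<in> trm_vars t"
    then have "v \<in> ifree_vars (Ind t1 t2 t3 :: ('f, 'r) ifm)" using that by auto
    then show "join Map.empty (restr V u) v = tot Map.empty u v"
      by (cases v) (auto simp: IFreeT_def V_def restr_def)
  qed
  have tv': "tuple_val M (restr V u) t1 = map (trm_val M (tot Map.empty u)) t1"
    "tuple_val M (restr V u) (t1 @ t2) = map (trm_val M (tot Map.empty u)) (t1 @ t2)"
    "tuple_val M (restr V u) (t1 @ t3) = map (trm_val M (tot Map.empty u)) (t1 @ t3)" for u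
    by (rule tv; force)+
  have it: "{s. in_team M h \<gamma> V s} = restr V ` team M h \<gamma>"
  proof (intro equalityI subsetI)
    fix s assume "s \<in> {s. in_team M h \<gamma> V s}"
    then have "in_team M h \<gamma> V s" by simp
    then obtain u where "range u \<subseteq> carr M" "s = restr V u" "sat M (tot h u) \<gamma>"
      using in_team_restrE[OF V assms] by metis
    then show "s \<in> restr V ` team M h \<gamma>" by (simp add: team_def)
  next
    fix s assume "s \<in> restr V ` team M h \<gamma>"
    then show "s \<in> {s. in_team M h \<gamma> V s}" using in_team_restrI[OF V] by (auto simp: team_def)
  qed
  have "ent_sat \<sigma> M (Ind t1 t2 t3) \<gamma> h \<longleftrightarrow>
    (\<forall>s \<in> {s. in_team M h \<gamma> V s}. \<forall>s' \<in> {s. in_team M h \<gamma> V s}.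
        tuple_val M s t1 = tuple_val M s' t1 \<longrightarrow>
        (\<exists>s'' \<in> {s. in_team M h \<gamma> V s}.
           tuple_val M s'' (t1 @ t2) = tuple_val M s (t1 @ t2) \<and>
           tuple_val M s'' (t1 @ t3) = tuple_val M s' (t1 @ t3)))"
    unfolding ent_sat.simps Let_def V_def[symmetric] Ball_def Bex_def mem_Collect_eq by blast
  also have "\<dots> \<longleftrightarrow> ind_team M (team M h \<gamma>) t1 t2 t3"
    unfolding it ind_team_def Let_def ball_simps bex_simps tv' ..
  finally show ?thesis .
qed

section \<open>Renaming of parameters\<close>

fun rename_trm :: "(var \<Rightarrow> var) \<Rightarrow> 'f trm \<Rightarrow> 'f trm" where
  "rename_trm \<pi> (Var x) = Var (\<pi> x)"
| "rename_trm \<pi> (Fn f ts) = Fn f (map (rename_trm \<pi>) ts)"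

fun rename_atom :: "(var \<Rightarrow> var) \<Rightarrow> ('f, 'r) atom \<Rightarrow> ('f, 'r) atom" where
  "rename_atom \<pi> (Rel r ts) = Rel r (map (rename_trm \<pi>) ts)"
| "rename_atom \<pi> (Equ t u) = Equ (rename_trm \<pi> t) (rename_trm \<pi> u)"

text \<open>Bound variables are renamed as well, so an injective renaming captures nothing.\<close>

fun rename_fm :: "(var \<Rightarrow> var) \<Rightarrow> ('f, 'r) fm \<Rightarrow> ('f, 'r) fm" where
  "rename_fm \<pi> (Atom a) = Atom (rename_atom \<pi> a)"
| "rename_fm \<pi> (Neg a) = Neg (rename_fm \<pi> a)"
| "rename_fm \<pi> (Con a b) = Con (rename_fm \<pi> a) (rename_fm \<pi> b)"
| "rename_fm \<pi> (Dis a b) = Dis (rename_fm \<pi> a) (rename_fm \<pi> b)"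
| "rename_fm \<pi> (Ex x a) = Ex (\<pi> x) (rename_fm \<pi> a)"
| "rename_fm \<pi> (All x a) = All (\<pi> x) (rename_fm \<pi> a)"

lemma trm_val_rename_trm: "trm_val M g (rename_trm \<pi> t) = trm_val M (g \<circ> \<pi>) t"
  by (induction t) (auto cong: map_cong simp: comp_def)

lemma atom_sat_rename_atom: "atom_sat M g (rename_atom \<pi> a) = atom_sat M (g \<circ> \<pi>) a"
  by (cases a) (auto simp: trm_val_rename_trm comp_def)

lemma sat_rename_fm:
  assumes "inj \<pi>"
  shows "sat M g (rename_fm \<pi> a) = sat M (g \<circ> \<pi>) a"
proof (induction a arbitrary: g)
  case (Ex x a)
  have "g(\<pi> x \<mapsto> u) \<circ> \<pi> = (g \<circ> \<pi>)(x \<mapsto> u)" for u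
    using assms by (auto simp: fun_eq_iff inj_def)
  then show ?case by (simp only: rename_fm.simps sat.simps Ex.IH)
next
  case (All x a)
  have "g(\<pi> x \<mapsto> u) \<circ> \<pi> = (g \<circ> \<pi>)(x \<mapsto> u)" for u
    using assms by (auto simp: fun_eq_iff inj_def)
  then show ?case by (simp only: rename_fm.simps sat.simps All.IH)
qed (auto simp: atom_sat_rename_atom)

lemma trm_vars_rename_trm: "trm_vars (rename_trm \<pi> t) = \<pi> ` trm_vars t"
  by (induction t) auto

lemma free_vars_rename_fm: "free_vars (rename_fm \<pi> a) \<subseteq> \<pi> ` free_vars a"
proof (induction a)
  case (Atom a)
  then show ?case by (cases a) (auto simp: trm_vars_rename_trm)
qed auto

lemma wf_rename_trm: "wf_trm \<sigma> (rename_trm \<pi> t) = wf_trm \<sigma> t"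
  by (induction t) auto

lemma wf_rename_fm: "wf_fm \<sigma> (rename_fm \<pi> a) = wf_fm \<sigma> a"
proof (induction a)
  case (Atom a)
  then show ?case by (cases a) (auto simp: wf_rename_trm)
qed auto

section \<open>Dependence of the entailment semantics on the team alone\<close>

text \<open>Witnesses found over \<open>k\<close> are to be used over \<open>h\<close>, although
  \<open>h\<close> and \<open>k\<close> may disagree on common parameters. Shifting the parameters
  of the witnesses above \<open>dom h\<close> makes room for the values that \<open>k\<close> gives
  them. A set \<open>F\<close> is treated at once because the two witnesses of a disjunction must
  share one assignment \<open>h'\<close>.\<close>

lemma par_transfer:
  fixes M :: "('f, 'r, 'u) struct"
  assumes h: "finite (dom h)" "ran h \<subseteq> carr M"
    and k: "ran k \<subseteq> carr M"
    and fin: "finite F" and F: "\<And>a. a \<in> F \<Longrightarrow> fm_over \<sigma> k a"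
  obtains h' \<tau> where "par_ext M h h'" "finite (dom h')"
    "\<And>a. a \<in> F \<Longrightarrow> fm_over \<sigma> h' (\<tau> a)"
    "\<And>a u. a \<in> F \<Longrightarrow> sat M (tot h' u) (\<tau> a) = sat M (tot k u) a"
proof -
  obtain N where N: "\<And>p. p \<in> dom h \<Longrightarrow> p < N"
    using h(1) unfolding finite_nat_set_iff_bounded by auto
  define P where "P = (\<Union>a \<in> F. FreeP a)"
  have finP: "finite P" using fin by (simp add: P_def finite_FreeP)
  \<comment> \<open>Below \<open>N\<close> this is \<open>h\<close>; the parameter
    \<open>p + N\<close> stands for the parameter \<open>p\<close> of \<open>k\<close>. Only the
    finite set \<open>P\<close> is copied: \<open>dom k\<close> may be infinite, while
    \<open>dom h'\<close> has to be finite for the next extension.\<close>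
  define h' where "h' p = (if p < N then h p else if p - N \<in> P then k (p - N) else None)" for p
  define \<pi> where "\<pi> v = (case v of Par p \<Rightarrow> Par (p + N) | Team x \<Rightarrow> Team x)" for v
  have \<pi>: "\<pi> (Par p) = Par (p + N)" "\<pi> (Team x) = Team x" for p x by (simp_all add: \<pi>_def)
  have inj: "inj \<pi>" 
  proof (rule injI)
    fix v w show "\<pi> v = \<pi> w \<Longrightarrow> v = w" by (cases v; cases w) (simp_all add: \<pi>)
  qed
  have h'k: "h' (p + N) = k p" if "p \<in> P" for p
    using that by (simp add: h'_def)
  have "par_ext M h h'"
    unfolding par_ext_def
  proof
    show "h \<subseteq>\<^sub>m h'" unfolding map_le_def by (simp add: N h'_def)
    show "ran h' \<subseteq> carr M"
    proof
      fix y assume "y \<in> ran h'"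
      then obtain p where "h' p = Some y" by (auto simp: ran_def)
      then have "h p = Some y \<or> k (p - N) = Some y" by (simp add: h'_def split: if_splits)
      then have "y \<in> ran h \<or> y \<in> ran k" by (blast intro: ranI)
      then show "y \<in> carr M" using h(2) k by blast
    qed
  qed
  moreover have "finite (dom h')"
  proof (rule finite_subset)
    show "dom h' \<subseteq> {..<N} \<union> (\<lambda>p. p + N) ` P"
    proof
      fix p assume "p \<in> dom h'"
      then have "p < N \<or> p - N \<in> P" by (auto simp: h'_def split: if_splits)
      moreover have "p = p - N + N" if "\<not> p < N" using that by simp
      ultimately show "p \<in> {..<N} \<union> (\<lambda>p. p + N) ` P"
        by (metis UnI1 UnI2 lessThan_iff image_eqI)
    qed
    show "finite ({..<N} \<union> (\<lambda>p. p + N) ` P)" using finP by simp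
  qed
  moreover have "fm_over \<sigma> h' (rename_fm \<pi> a)" if a: "a \<in> F" for a
    unfolding fm_over_def
  proof
    show "wf_fm \<sigma> (rename_fm \<pi> a)" using F[OF a] by (simp add: wf_rename_fm fm_over_def)
    show "FreeP (rename_fm \<pi> a) \<subseteq> dom h'"
    proof
      fix q assume "q \<in> FreeP (rename_fm \<pi> a)"
      then obtain v where v: "v \<in> free_vars a" "Par q = \<pi> v"
        using subsetD[OF free_vars_rename_fm, of "Par q" \<pi> a] by (auto simp: FreeP_def)
      then obtain p where p: "v = Par p" "q = p + N" by (cases v) (auto simp: \<pi>)
      then have "p \<in> FreeP a" using v by (simp add: FreeP_def)
      moreover from this have "p \<in> P" using a by (auto simp: P_def)
      moreover have "p \<in> dom k" using F[OF a] \<open>p \<in> FreeP a\<close> by (auto simp: fm_over_def)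
      ultimately show "q \<in> dom h'" by (simp add: p h'k domIff)
    qed
  qed
  moreover have "sat M (tot h' u) (rename_fm \<pi> a) = sat M (tot k u) a" if a: "a \<in> F" for a u
    unfolding sat_rename_fm[OF inj]
  proof (rule sat_cong)
    fix v assume "v \<in> free_vars a"
    show "(tot h' u \<circ> \<pi>) v = tot k u v"
    proof (cases v)
      case (Par p)
      then have "p \<in> P" using a \<open>v \<in> free_vars a\<close> by (auto simp: P_def FreeP_def)
      then show ?thesis using Par by (simp add: \<pi> h'k)
    qed (simp add: \<pi>)
  qed
  ultimately show ?thesis by (rule that)
qed

text \<open>
  Finiteness of \<open>dom h\<close> cannot be dropped: a total \<open>h\<close> has no proper extension, so it cannot supply
  the parameters that the witnesses for \<open>k\<close> use.
\<close>

lemma ent_sat_team_cong: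
  fixes M :: "('f, 'r, 'u) struct"
  assumes "carr M \<noteq> {}" "ent_sat \<sigma> M \<phi> \<gamma> k" "FreeP \<gamma> \<subseteq> dom k"
    and "finite (dom h)" "ran h \<subseteq> carr M" "FreeP \<delta> \<subseteq> dom h"
    and "\<And>u. range u \<subseteq> carr M \<Longrightarrow> sat M (tot k u) \<gamma> = sat M (tot h u) \<delta>"
  shows "ent_sat \<sigma> M \<phi> \<delta> h"
  using assms(2-)
proof (induction \<phi> arbitrary: \<gamma> k \<delta> h)
  case (Lit l)
  then show ?case unfolding ent_sat_Lit_iff[OF assms(1)] by simp
next
  case (Ind t1 t2 t3)
  then have "team M k \<gamma> = team M h \<delta>" by (auto simp only: team_def)
  then show ?case using Ind.prems(1) unfolding ent_sat_Ind_iff[OF assms(1)] by simp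
next
  case (IDis \<phi>1 \<phi>2)
  then obtain k' \<gamma>1 \<gamma>2 where k': "par_ext M k k'" "fm_over \<sigma> k' \<gamma>1" "fm_over \<sigma> k' \<gamma>2"
    "ent_sat \<sigma> M \<phi>1 \<gamma>1 k'" "ent_sat \<sigma> M \<phi>2 \<gamma>2 k'"
    "sat_par M k' (closeT (Iff \<gamma> (Dis \<gamma>1 \<gamma>2)))"
    unfolding ent_sat.simps by blast
  obtain h' \<tau> where h': "par_ext M h h'" "finite (dom h')"
    "\<And>a. a \<in> {\<gamma>1, \<gamma>2} \<Longrightarrow> fm_over \<sigma> h' (\<tau> a)"
    "\<And>a u. a \<in> {\<gamma>1, \<gamma>2} \<Longrightarrow> sat M (tot h' u) (\<tau> a) = sat M (tot k' u) a"
    by (rule par_transfer[of h M k' "{\<gamma>1, \<gamma>2}" \<sigma>])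
      (use IDis.prems k' in \<open>auto simp: par_ext_def\<close>)
  \<comment> \<open>The parameters of \<open>\<gamma>\<close> and \<open>\<delta>\<close> lie in the
    old domains, so the extensions leave both teams as they were and the hypothesis carries over to
    \<open>k'\<close> and \<open>h'\<close>.\<close>
  have \<delta>: "sat M (tot h' u) \<delta> = sat M (tot k' u) \<gamma>" if "range u \<subseteq> carr M" for u
  proof -
    have "sat M (tot h' u) \<delta> = sat M (tot h u) \<delta>"
      by (rule sat_tot_par_ext[OF h'(1) IDis.prems(5)])
    moreover have "sat M (tot k' u) \<gamma> = sat M (tot k u) \<gamma>"
      by (rule sat_tot_par_ext[OF k'(1) IDis.prems(2)])
    ultimately show ?thesis using IDis.prems(6)[OF that] by simp
  qed
  \<comment> \<open>The induction hypothesis compares \<open>\<gamma>1\<close> over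
    \<open>k'\<close> with its renamed copy over \<open>h'\<close>; it applies because
    \<open>dom h'\<close> is again finite.\<close>
  have "ent_sat \<sigma> M \<phi>1 (\<tau> \<gamma>1) h'"
    by (rule IDis.IH(1)[OF k'(4)]) (use k' h' in \<open>auto simp: fm_over_def par_ext_def\<close>)
  moreover have "ent_sat \<sigma> M \<phi>2 (\<tau> \<gamma>2) h'"
    by (rule IDis.IH(2)[OF k'(5)]) (use k' h' in \<open>auto simp: fm_over_def par_ext_def\<close>)
  moreover have "sat_par M h' (closeT (Iff \<delta> (Dis (\<tau> \<gamma>1) (\<tau> \<gamma>2))))"
    using k'(6) h'(4) \<delta> unfolding sat_closeT[OF assms(1)] by simp
  ultimately show ?case using h'(1,3) unfolding ent_sat.simps by blast
next
  case (ICon \<phi>1 \<phi>2)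
  have "ent_sat \<sigma> M \<phi>1 \<delta> h"
    by (rule ICon.IH(1)[of \<gamma> k]) (use ICon.prems in auto)
  moreover have "ent_sat \<sigma> M \<phi>2 \<delta> h"
    by (rule ICon.IH(2)[of \<gamma> k]) (use ICon.prems in auto)
  ultimately show ?case by simp
next
  case (IEx x \<phi>)
  then obtain k' \<gamma>' where k': "par_ext M k k'" "fm_over \<sigma> k' \<gamma>'" "ent_sat \<sigma> M \<phi> \<gamma>' k'"
    "sat_par M k' (closeT (Iff (Ex (Team x) \<gamma>') (Ex (Team x) \<gamma>)))"
    unfolding ent_sat.simps by blast
  obtain h' \<tau> where h': "par_ext M h h'" "finite (dom h')"
    "\<And>a. a \<in> {\<gamma>'} \<Longrightarrow> fm_over \<sigma> h' (\<tau> a)"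
    "\<And>a u. a \<in> {\<gamma>'} \<Longrightarrow> sat M (tot h' u) (\<tau> a) = sat M (tot k' u) a"
    by (rule par_transfer[of h M k' "{\<gamma>'}" \<sigma>])
      (use IEx.prems k' in \<open>auto simp: par_ext_def\<close>)
  have \<delta>: "sat M (tot h' u) \<delta> = sat M (tot k' u) \<gamma>" if "range u \<subseteq> carr M" for u
  proof -
    have "sat M (tot h' u) \<delta> = sat M (tot h u) \<delta>"
      by (rule sat_tot_par_ext[OF h'(1) IEx.prems(5)])
    moreover have "sat M (tot k' u) \<gamma> = sat M (tot k u) \<gamma>"
      by (rule sat_tot_par_ext[OF k'(1) IEx.prems(2)])
    ultimately show ?thesis using IEx.prems(6)[OF that] by simp
  qed
  \<comment> \<open>The teams are known to agree only on assignments into the carrier; these are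
    closed under the updates that evaluate \<open>Ex (Team x)\<close>.\<close>
  have "range (u(x := c)) \<subseteq> carr M" if "range u \<subseteq> carr M" "c \<in> carr M" for u c
    using that by auto
  then have "sat M (tot h' u) (Ex (Team x) \<delta>) = sat M (tot k' u) (Ex (Team x) \<gamma>)"
    if "range u \<subseteq> carr M" for u
    using that \<delta> by (simp add: tot_upd)
  moreover have "sat M (tot h' u) (Ex (Team x) (\<tau> \<gamma>')) = sat M (tot k' u) (Ex (Team x) \<gamma>')" for u
    using h'(4) by (simp add: tot_upd)
  ultimately have "sat_par M h' (closeT (Iff (Ex (Team x) (\<tau> \<gamma>')) (Ex (Team x) \<delta>)))"
    using k'(4) unfolding sat_closeT[OF assms(1)] by (simp del: sat.simps(5))
  moreover have "ent_sat \<sigma> M \<phi> (\<tau> \<gamma>') h'"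
    by (rule IEx.IH[OF k'(3)]) (use k' h' in \<open>auto simp: fm_over_def par_ext_def\<close>)
  ultimately show ?case using h'(1,3) unfolding ent_sat.simps by blast
next
  case (IAll x \<phi>)
  then obtain k' \<gamma>' where k': "par_ext M k k'" "fm_over \<sigma> k' \<gamma>'" "ent_sat \<sigma> M \<phi> \<gamma>' k'"
    "sat_par M k' (closeT (Iff \<gamma>' (Ex (Team x) \<gamma>)))"
    unfolding ent_sat.simps by blast
  obtain h' \<tau> where h': "par_ext M h h'" "finite (dom h')"
    "\<And>a. a \<in> {\<gamma>'} \<Longrightarrow> fm_over \<sigma> h' (\<tau> a)"
    "\<And>a u. a \<in> {\<gamma>'} \<Longrightarrow> sat M (tot h' u) (\<tau> a) = sat M (tot k' u) a"
    by (rule par_transfer[of h M k' "{\<gamma>'}" \<sigma>])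
      (use IAll.prems k' in \<open>auto simp: par_ext_def\<close>)
  have \<delta>: "sat M (tot h' u) \<delta> = sat M (tot k' u) \<gamma>" if "range u \<subseteq> carr M" for u
  proof -
    have "sat M (tot h' u) \<delta> = sat M (tot h u) \<delta>"
      by (rule sat_tot_par_ext[OF h'(1) IAll.prems(5)])
    moreover have "sat M (tot k' u) \<gamma> = sat M (tot k u) \<gamma>"
      by (rule sat_tot_par_ext[OF k'(1) IAll.prems(2)])
    ultimately show ?thesis using IAll.prems(6)[OF that] by simp
  qed
  have "range (u(x := c)) \<subseteq> carr M" if "range u \<subseteq> carr M" "c \<in> carr M" for u c
    using that by auto
  then have "sat M (tot h' u) (Ex (Team x) \<delta>) = sat M (tot k' u) (Ex (Team x) \<gamma>)"
    if "range u \<subseteq> carr M" for u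
    using that \<delta> by (simp add: tot_upd)
  then have "sat_par M h' (closeT (Iff (\<tau> \<gamma>') (Ex (Team x) \<delta>)))"
    using k'(4) h'(4) unfolding sat_closeT[OF assms(1)] by (simp del: sat.simps(5))
  moreover have "ent_sat \<sigma> M \<phi> (\<tau> \<gamma>') h'"
    by (rule IAll.IH[OF k'(3)]) (use k' h' in \<open>auto simp: fm_over_def par_ext_def\<close>)
  ultimately show ?case using h'(1,3) unfolding ent_sat.simps by blast
qed

section \<open>The downward Loewenheim-Skolem theorem\<close>

text \<open>Formal terms over countably many symbols, each usable with every number of arguments; an
  application to the empty list acts as a constant. Countability of the hull is inherited from this
  datatype.\<close>

datatype skolem_term = Skolem nat "skolem_term list"

instance skolem_term :: countable
  by countable_datatype

fun skolem_val :: "(nat \<Rightarrow> 'u list \<Rightarrow> 'u) \<Rightarrow> skolem_term \<Rightarrow> 'u" where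
  "skolem_val F (Skolem i ts) = F i (map (skolem_val F) ts)"

text \<open>The hull consists of the values of all formal terms. It is closed because applying a
  function of \<open>K\<close> is a term constructor. No seed elements are prescribed: the values at
  the empty list start the generation.\<close>

lemma countable_hull:
  fixes K :: "('u list \<Rightarrow> 'u) set"
  assumes "countable K" "\<And>k as. k \<in> K \<Longrightarrow> set as \<subseteq> D \<Longrightarrow> k as \<in> D" "K \<noteq> {}"
  obtains C where "countable C" "C \<subseteq> D" "\<And>k as. k \<in> K \<Longrightarrow> set as \<subseteq> C \<Longrightarrow> k as \<in> C"
proof -
  define F where "F = from_nat_into K"
  have range: "range F = K"
    unfolding F_def using assms by (simp add: range_from_nat_into)
  show ?thesis
  proof
    show "countable (range (skolem_val F))" by simp
    show "range (skolem_val F) \<subseteq> D"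
    proof
      fix c assume "c \<in> range (skolem_val F)"
      then obtain t where c: "c = skolem_val F t" by auto
      have "skolem_val F t \<in> D"
      proof (induction t)
        case (Skolem i ts)
        then have "set (map (skolem_val F) ts) \<subseteq> D" by auto
        then show ?case using assms(2) range by auto
      qed
      with c show "c \<in> D" by simp
    qed
    fix k as assume k: "k \<in> K" "set as \<subseteq> range (skolem_val F)"
    obtain i where i: "k = F i" using k range by auto
    have "\<forall>a \<in> set as. \<exists>t. a = skolem_val F t" using k(2) by blast
    then obtain ts where "as = map (skolem_val F) ts" unfolding ex_map_conv[symmetric] by blast
    then have "k as = skolem_val F (Skolem i ts)" using i by simp
    then show "k as \<in> range (skolem_val F)" by blast
  qed
qed

text \<open>This is a Skolem function for \<open>Ex x b\<close>, with the Tarski-Vaught criterion as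
  its property. Its arguments are the values of the other free variables of \<open>b\<close> in a
  fixed order, so a single \<open>k\<close> serves every \<open>C\<close> and every
  \<open>g\<close>.\<close>

lemma witness_function:
  fixes M :: "('f, 'r, 'u) struct"
  assumes "carr M \<noteq> {}"
  obtains k where "\<And>as. k as \<in> carr M"
    "\<And>C g. \<lbrakk>C \<subseteq> carr M; \<And>as. set as \<subseteq> C \<Longrightarrow> k as \<in> C; ran g \<subseteq> C; free_vars b - {x} \<subseteq> dom g\<rbrakk> \<Longrightarrow>
      (\<exists>u \<in> C. sat M (g(x \<mapsto> u)) b) \<longleftrightarrow> (\<exists>u \<in> carr M. sat M (g(x \<mapsto> u)) b)"
proof -
  obtain xs where xs: "set xs = free_vars b - {x}"
    using finite_free_vars[of b] by (metis finite_Diff finite_list)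
  define W where "W as u \<longleftrightarrow> u \<in> carr M \<and> sat M ((map_of (zip xs as))(x \<mapsto> u)) b" for as u
  \<comment> \<open>Where no witness exists, \<open>k\<close> still has to return a carrier element,
    since the hull is formed by applying it to all lists.\<close>
  define k where "k as = (if \<exists>u. W as u then SOME u. W as u else SOME u. u \<in> carr M)" for as
  have k: "W as (k as)" if "W as u" for as u
    using that someI_ex[of "W as"] by (auto simp: k_def)
  show ?thesis
  proof
    show "k as \<in> carr M" for as
    proof (cases "\<exists>u. W as u")
      case True
      then show ?thesis using k by (auto simp: W_def)
    next
      case False
      then show ?thesis using assms by (simp add: k_def some_in_eq)
    qed
    fix C g
    assume C: "C \<subseteq> carr M" "\<And>as. set as \<subseteq> C \<Longrightarrow> k as \<in> C"
      and g: "ran g \<subseteq> C" "free_vars b - {x} \<subseteq> dom g"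
    define as where "as = map (\<lambda>v. the (g v)) xs"
    have as: "set as \<subseteq> C"
    proof
      fix y assume "y \<in> set as"
      then obtain v where v: "v \<in> set xs" "y = the (g v)" by (auto simp: as_def)
      then have "g v = Some y" using g(2) xs by auto
      then show "y \<in> C" using g(1) by (blast intro: ranI)
    qed
    have "sat M ((map_of (zip xs as))(x \<mapsto> u)) b = sat M (g(x \<mapsto> u)) b" for u
    proof (rule sat_cong)
      fix v assume "v \<in> free_vars b"
      then show "((map_of (zip xs as))(x \<mapsto> u)) v = (g(x \<mapsto> u)) v"
        using g xs by (auto simp: as_def map_of_zip_map)
    qed
    then have W: "W as u \<longleftrightarrow> u \<in> carr M \<and> sat M (g(x \<mapsto> u)) b" for u by (simp add: W_def)
    show "(\<exists>u \<in> C. sat M (g(x \<mapsto> u)) b) \<longleftrightarrow> (\<exists>u \<in> carr M. sat M (g(x \<mapsto> u)) b)"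
    proof
      assume "\<exists>u \<in> carr M. sat M (g(x \<mapsto> u)) b"
      then have "W as (k as)" using W k by blast
      then show "\<exists>u \<in> C. sat M (g(x \<mapsto> u)) b" using W C(2)[OF as] by blast
    qed (use C(1) in blast)
  qed
qed

text \<open>Elementarity of \<open>C\<close> in \<open>M\<close> for one formula. Only the range of
  the quantifiers changes while terms are still evaluated in \<open>M\<close>, so closure of
  \<open>C\<close> under function symbols can be treated separately.\<close>

definition reflects :: "('f, 'r, 'u) struct \<Rightarrow> 'u set \<Rightarrow> ('f, 'r) fm \<Rightarrow> bool" where
  "reflects M C a \<longleftrightarrow> (\<forall>g. ran g \<subseteq> C \<and> free_vars a \<subseteq> dom g \<longrightarrow>
     sat (M\<lparr>carr := C\<rparr>) g a = sat M g a)"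

text \<open>\<open>K\<close> is chosen independently of \<open>C\<close>, so the functions for
  several formulas can be collected before one common hull is formed.\<close>

definition skolem_fns :: "('f, 'r, 'u) struct \<Rightarrow> ('f, 'r) fm \<Rightarrow> ('u list \<Rightarrow> 'u) set \<Rightarrow> bool" where
  "skolem_fns M a K \<longleftrightarrow> finite K \<and> (\<forall>k \<in> K. \<forall>as. k as \<in> carr M) \<and>
     (\<forall>C \<subseteq> carr M. (\<forall>k \<in> K. \<forall>as. set as \<subseteq> C \<longrightarrow> k as \<in> C) \<longrightarrow> reflects M C a)"

lemma skolem_fnsD:
  assumes "skolem_fns M a K" "C \<subseteq> carr M" "\<forall>k \<in> K. \<forall>as. set as \<subseteq> C \<longrightarrow> k as \<in> C"
  shows "reflects M C a"
  using assms unfolding skolem_fns_def by blast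

text \<open>Closure under a larger set of functions is the stronger demand on \<open>C\<close>, so
  reflection of the subformulas in \<open>A\<close> survives the passage to
  \<open>K\<close>.\<close>

lemma skolem_fns_extend:
  assumes "\<And>a. a \<in> A \<Longrightarrow> \<exists>K' \<subseteq> K. skolem_fns M a K'"
    and "finite K" "\<And>k as. k \<in> K \<Longrightarrow> k as \<in> carr M"
    and "\<And>C. \<lbrakk>C \<subseteq> carr M; \<forall>k \<in> K. \<forall>as. set as \<subseteq> C \<longrightarrow> k as \<in> C; \<And>a. a \<in> A \<Longrightarrow> reflects M C a\<rbrakk>
      \<Longrightarrow> reflects M C b"
  shows "skolem_fns M b K"
  unfolding skolem_fns_def
proof (intro conjI allI impI ballI)
  fix C assume C: "C \<subseteq> carr M" "\<forall>k \<in> K. \<forall>as. set as \<subseteq> C \<longrightarrow> k as \<in> C"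
  have "reflects M C a" if a: "a \<in> A" for a
  proof -
    obtain K' where "K' \<subseteq> K" "skolem_fns M a K'" using assms(1)[OF a] by blast
    moreover have "\<forall>k \<in> K'. \<forall>as. set as \<subseteq> C \<longrightarrow> k as \<in> C" using C(2) calculation(1) by blast
    ultimately show ?thesis using skolem_fnsD C(1) by blast
  qed
  then show "reflects M C b" using assms(4) C by blast
qed (use assms in auto)

lemma skolem_fns_fin: "skolem_fns M a K \<Longrightarrow> finite K"
  and skolem_fns_carr: "skolem_fns M a K \<Longrightarrow> k \<in> K \<Longrightarrow> k as \<in> carr M"
  by (simp_all add: skolem_fns_def)

lemma carr_carr_update: "carr (M\<lparr>carr := C\<rparr>) = C"
  by simp

lemma trm_val_carr_update: "trm_val (M\<lparr>carr := C\<rparr>) g t = trm_val M g t"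
  by (induction t) (auto cong: map_cong)

lemma atom_sat_carr_update: "atom_sat (M\<lparr>carr := C\<rparr>) g a = atom_sat M g a"
  by (cases a) (auto simp: trm_val_carr_update cong: map_cong)

lemma ex_skolem_fns:
  fixes M :: "('f, 'r, 'u) struct"
  assumes "carr M \<noteq> {}"
  shows "\<exists>K. skolem_fns M a K"
proof (induction a)
  case (Atom a)
  have "skolem_fns M (Atom a) {}"
    by (simp add: skolem_fns_def reflects_def atom_sat_carr_update)
  then show ?case ..
next
  case (Neg a)
  then show ?case by (simp add: skolem_fns_def reflects_def)
next
  case (Con a b)
  then obtain K L where K: "skolem_fns M a K" and L: "skolem_fns M b L" by blast
  have "reflects M C (Con a b)" if "reflects M C a" "reflects M C b" for C
    using that by (simp add: reflects_def)
  note reflects = this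
  have "skolem_fns M (Con a b) (K \<union> L)"
  proof (rule skolem_fns_extend[of "{a, b}"])
    show "\<exists>K' \<subseteq> K \<union> L. skolem_fns M c K'" if "c \<in> {a, b}" for c
      using that K L by blast
    show "finite (K \<union> L)" using skolem_fns_fin[OF K] skolem_fns_fin[OF L] by simp
    show "k as \<in> carr M" if "k \<in> K \<union> L" for k as
      using that skolem_fns_carr[OF K] skolem_fns_carr[OF L] by (cases "k \<in> K") simp_all
  qed (rule reflects; simp)
  then show ?case ..
next
  case (Dis a b)
  then obtain K L where K: "skolem_fns M a K" and L: "skolem_fns M b L" by blast
  have "reflects M C (Dis a b)" if "reflects M C a" "reflects M C b" for C
    using that by (simp add: reflects_def)
  note reflects = this
  have "skolem_fns M (Dis a b) (K \<union> L)"
  proof (rule skolem_fns_extend[of "{a, b}"])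
    show "\<exists>K' \<subseteq> K \<union> L. skolem_fns M c K'" if "c \<in> {a, b}" for c
      using that K L by blast
    show "finite (K \<union> L)" using skolem_fns_fin[OF K] skolem_fns_fin[OF L] by simp
    show "k as \<in> carr M" if "k \<in> K \<union> L" for k as
      using that skolem_fns_carr[OF K] skolem_fns_carr[OF L] by (cases "k \<in> K") simp_all
  qed (rule reflects; simp)
  then show ?case ..
next
  case (Ex x a)
  then obtain K where K: "skolem_fns M a K" by blast
  obtain k where k: "\<And>as. k as \<in> carr M"
    "\<And>C g. \<lbrakk>C \<subseteq> carr M; \<And>as. set as \<subseteq> C \<Longrightarrow> k as \<in> C; ran g \<subseteq> C; free_vars a - {x} \<subseteq> dom g\<rbrakk> \<Longrightarrow>
      (\<exists>u \<in> C. sat M (g(x \<mapsto> u)) a) \<longleftrightarrow> (\<exists>u \<in> carr M. sat M (g(x \<mapsto> u)) a)"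
    by (rule witness_function[OF assms, of a x]) blast
  have "reflects M C (Ex x a)"
    if C: "C \<subseteq> carr M" "\<forall>k' \<in> insert k K. \<forall>as. set as \<subseteq> C \<longrightarrow> k' as \<in> C" and a: "reflects M C a" for C
    unfolding reflects_def
  proof (intro allI impI)
    fix g assume g: "ran g \<subseteq> C \<and> free_vars (Ex x a) \<subseteq> dom g"
    have "sat (M\<lparr>carr := C\<rparr>) (g(x \<mapsto> u)) a = sat M (g(x \<mapsto> u)) a" if "u \<in> C" for u
    proof -
      have "ran (g(x \<mapsto> u)) \<subseteq> C" "free_vars a \<subseteq> dom (g(x \<mapsto> u))"
        using g that by (auto simp: ran_def)
      then show ?thesis using a unfolding reflects_def by blast
    qed
    then have "sat (M\<lparr>carr := C\<rparr>) g (Ex x a) \<longleftrightarrow> (\<exists>u \<in> C. sat M (g(x \<mapsto> u)) a)"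
      by simp
    also have "\<dots> \<longleftrightarrow> sat M g (Ex x a)"
    proof -
      have "set as \<subseteq> C \<Longrightarrow> k as \<in> C" for as using C(2) by blast
      then have "(\<exists>u \<in> C. sat M (g(x \<mapsto> u)) a) \<longleftrightarrow> (\<exists>u \<in> carr M. sat M (g(x \<mapsto> u)) a)"
        by (rule k(2)[OF C(1)]) (use g in auto)
      then show ?thesis by simp
    qed
    finally show "sat (M\<lparr>carr := C\<rparr>) g (Ex x a) = sat M g (Ex x a)" .
  qed
  note reflects = this
  have "skolem_fns M (Ex x a) (insert k K)"
  proof (rule skolem_fns_extend[of "{a}"])
    show "\<exists>K' \<subseteq> insert k K. skolem_fns M b K'" if "b \<in> {a}" for b
      using that K by blast
    show "finite (insert k K)" using skolem_fns_fin[OF K] by simp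
    show "k' as \<in> carr M" if "k' \<in> insert k K" for k' as
      using that k(1) skolem_fns_carr[OF K] by (cases "k' = k") simp_all
  qed (rule reflects; simp)
  then show ?case ..
next
  case (All x a)
  then obtain K where K: "skolem_fns M a K" by blast
  \<comment> \<open>A counterexample to \<open>a\<close> is a witness for
    \<open>Neg a\<close>.\<close>
  obtain k where k: "\<And>as. k as \<in> carr M"
    "\<And>C g. \<lbrakk>C \<subseteq> carr M; \<And>as. set as \<subseteq> C \<Longrightarrow> k as \<in> C; ran g \<subseteq> C; free_vars (Neg a) - {x} \<subseteq> dom g\<rbrakk> \<Longrightarrow>
      (\<exists>u \<in> C. sat M (g(x \<mapsto> u)) (Neg a)) \<longleftrightarrow> (\<exists>u \<in> carr M. sat M (g(x \<mapsto> u)) (Neg a))"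
    by (rule witness_function[OF assms, of "Neg a" x]) blast
  have "reflects M C (All x a)"
    if C: "C \<subseteq> carr M" "\<forall>k' \<in> insert k K. \<forall>as. set as \<subseteq> C \<longrightarrow> k' as \<in> C" and a: "reflects M C a" for C
    unfolding reflects_def
  proof (intro allI impI)
    fix g assume g: "ran g \<subseteq> C \<and> free_vars (All x a) \<subseteq> dom g"
    have "sat (M\<lparr>carr := C\<rparr>) (g(x \<mapsto> u)) a = sat M (g(x \<mapsto> u)) a" if "u \<in> C" for u
    proof -
      have "ran (g(x \<mapsto> u)) \<subseteq> C" "free_vars a \<subseteq> dom (g(x \<mapsto> u))"
        using g that by (auto simp: ran_def)
      then show ?thesis using a unfolding reflects_def by blast
    qed
    then have "sat (M\<lparr>carr := C\<rparr>) g (All x a) \<longleftrightarrow> \<not> (\<exists>u \<in> C. \<not> sat M (g(x \<mapsto> u)) a)"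
      by simp
    also have "\<dots> \<longleftrightarrow> sat M g (All x a)"
    proof -
      have "set as \<subseteq> C \<Longrightarrow> k as \<in> C" for as using C(2) by blast
      then have "(\<exists>u \<in> C. sat M (g(x \<mapsto> u)) (Neg a)) \<longleftrightarrow> (\<exists>u \<in> carr M. sat M (g(x \<mapsto> u)) (Neg a))"
        by (rule k(2)[OF C(1)]) (use g in auto)
      then show ?thesis by simp
    qed
    finally show "sat (M\<lparr>carr := C\<rparr>) g (All x a) = sat M g (All x a)" .
  qed
  note reflects = this
  have "skolem_fns M (All x a) (insert k K)"
  proof (rule skolem_fns_extend[of "{a}"])
    show "\<exists>K' \<subseteq> insert k K. skolem_fns M b K'" if "b \<in> {a}" for b
      using that K by blast
    show "finite (insert k K)" using skolem_fns_fin[OF K] by simp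
    show "k' as \<in> carr M" if "k' \<in> insert k K" for k' as
      using that k(1) skolem_fns_carr[OF K] by (cases "k' = k") simp_all
  qed (rule reflects; simp)
  then show ?case ..
qed

section \<open>Copying a countable hull into the type \<open>'e\<close>\<close>

lemma finite_set_trm: "finite (set_trm t)"
  by (induction t) auto

lemma finite_set1_fm: "finite (set1_fm a)"
proof (induction a)
  case (Atom a)
  then show ?case by (cases a) (auto simp: finite_set_trm)
qed auto

text \<open>\<open>e\<close> acts as an isomorphism from \<open>C\<close> onto the carrier of
  \<open>N\<close>, but only for the function symbols in \<open>S\<close>. The signature may be
  uncountable, and a countable hull cannot be expected to be closed under all of its
  symbols.\<close>

locale embedding =
  fixes \<sigma> :: "('f, 'r) signature" and M :: "('f, 'r, 'u) struct" and C :: "'u set"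
    and e :: "'u \<Rightarrow> 'e" and S :: "'f set" and N :: "('f, 'r, 'e) struct"
  assumes inj: "inj_on e C"
    and carr_N: "carr N = e ` C"
    and fun_closed: "\<And>f as. f \<in> S \<Longrightarrow> fun_arity \<sigma> f = Some (length as) \<Longrightarrow> set as \<subseteq> C \<Longrightarrow>
      fun_int M f as \<in> C"
    and fun_N: "\<And>f as. f \<in> S \<Longrightarrow> set as \<subseteq> C \<Longrightarrow> fun_int N f (map e as) = e (fun_int M f as)"
    and rel_N: "\<And>r as. set as \<subseteq> C \<Longrightarrow> rel_int N r (map e as) = rel_int M r as"
begin

text \<open>Membership in \<open>C\<close> is proved together with the equation, because
  \<open>fun_N\<close> speaks only of arguments in \<open>C\<close>.\<close>

lemma trm_val_embedding:
  assumes "ran g \<subseteq> C"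
  shows "wf_trm \<sigma> t \<Longrightarrow> set_trm t \<subseteq> S \<Longrightarrow> trm_vars t \<subseteq> dom g \<Longrightarrow>
    trm_val M g t \<in> C \<and> trm_val N (map_option e \<circ> g) t = e (trm_val M g t)"
proof (induction t)
  case (Var v)
  then show ?case using assms by (auto simp: ran_def)
next
  case (Fn f ts)
  have IH: "\<forall>t \<in> set ts. trm_val M g t \<in> C \<and>
      trm_val N (map_option e \<circ> g) t = e (trm_val M g t)"
  proof
    fix t assume "t \<in> set ts"
    then show "trm_val M g t \<in> C \<and> trm_val N (map_option e \<circ> g) t = e (trm_val M g t)"
      by (intro Fn.IH) (use Fn.prems in auto)
  qed
  then have "set (map (trm_val M g) ts) \<subseteq> C" by auto
  moreover have "map (trm_val N (map_option e \<circ> g)) ts = map e (map (trm_val M g) ts)"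
    using IH by simp
  moreover have "f \<in> S" "fun_arity \<sigma> f = Some (length (map (trm_val M g) ts))"
    using Fn.prems by auto
  ultimately show ?case using fun_closed fun_N by (metis trm_val.simps(2))
qed

lemma atom_sat_embedding:
  assumes "ran g \<subseteq> C" "wf_atom \<sigma> a" "set1_atom a \<subseteq> S" "atom_vars a \<subseteq> dom g"
  shows "atom_sat N (map_option e \<circ> g) a = atom_sat M g a"
proof (cases a)
  case (Rel r ts)
  have IH: "\<forall>t \<in> set ts. trm_val M g t \<in> C \<and>
      trm_val N (map_option e \<circ> g) t = e (trm_val M g t)"
    using trm_val_embedding[OF assms(1)] assms(2-) Rel by (auto simp: UN_subset_iff)
  then have "set (map (trm_val M g) ts) \<subseteq> C" by auto
  moreover have "map (trm_val N (map_option e \<circ> g)) ts = map e (map (trm_val M g) ts)"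
    using IH by simp
  ultimately show ?thesis using rel_N Rel by (metis atom_sat.simps(1))
next
  case (Equ t u)
  then show ?thesis
    using trm_val_embedding[OF assms(1), of t] trm_val_embedding[OF assms(1), of u] assms(2-) inj
    by (auto dest: inj_onD)
qed

lemma sat_embedding:
  "ran g \<subseteq> C \<Longrightarrow> wf_fm \<sigma> a \<Longrightarrow> set1_fm a \<subseteq> S \<Longrightarrow> free_vars a \<subseteq> dom g \<Longrightarrow>
    sat N (map_option e \<circ> g) a = sat (M\<lparr>carr := C\<rparr>) g a"
proof (induction a arbitrary: g)
  have ran: "ran (g(x \<mapsto> u)) \<subseteq> C" if "ran g \<subseteq> C" "u \<in> C" for g :: "var \<rightharpoonup> 'u" and x u
    using that by (auto simp: ran_def)
  {
    case (Ex x a)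
    have "sat N ((map_option e \<circ> g)(x \<mapsto> e u)) a = sat (M\<lparr>carr := C\<rparr>) (g(x \<mapsto> u)) a"
      if "u \<in> C" for u
      unfolding map_option_o_map_upd[symmetric]
      by (rule Ex.IH[OF ran[OF Ex.prems(1) that]]) (use Ex.prems in auto)
    then have "(\<exists>u \<in> carr N. sat N ((map_option e \<circ> g)(x \<mapsto> u)) a) \<longleftrightarrow>
        (\<exists>u \<in> C. sat (M\<lparr>carr := C\<rparr>) (g(x \<mapsto> u)) a)"
      unfolding carr_N by blast
    then show ?case by (simp only: sat.simps carr_carr_update)
  }
  {
    case (All x a)
    have "sat N ((map_option e \<circ> g)(x \<mapsto> e u)) a = sat (M\<lparr>carr := C\<rparr>) (g(x \<mapsto> u)) a"
      if "u \<in> C" for u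
      unfolding map_option_o_map_upd[symmetric]
      by (rule All.IH[OF ran[OF All.prems(1) that]]) (use All.prems in auto)
    then have "(\<forall>u \<in> carr N. sat N ((map_option e \<circ> g)(x \<mapsto> u)) a) \<longleftrightarrow>
        (\<forall>u \<in> C. sat (M\<lparr>carr := C\<rparr>) (g(x \<mapsto> u)) a)"
      unfolding carr_N by blast
    then show ?case by (simp only: sat.simps carr_carr_update)
  }
qed (auto simp: atom_sat_embedding atom_sat_carr_update)

end

text \<open>The hull is closed only under the symbols that occur in \<open>F\<close>, which are
  finitely many; the other function symbols are reinterpreted in \<open>N\<close>. So
  \<open>N\<close> need not be a copy of a substructure of \<open>M\<close>, but the two agree on
  \<open>F\<close>.\<close>

theorem downward_loewenheim_skolem:
  fixes M :: "('f, 'r, 'u) struct" and h :: "nat \<rightharpoonup> 'u"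
  assumes inf: "infinite (UNIV :: 'e set)"
    and M: "is_struct \<sigma> M"
    and F: "finite F" "\<And>a. a \<in> F \<Longrightarrow> wf_fm \<sigma> a \<and> FreeT a = {} \<and> FreeP a \<subseteq> dom h"
    and h: "finite (dom h)" "ran h \<subseteq> carr M"
  obtains N :: "('f, 'r, 'e) struct" and h' where "is_struct \<sigma> N" "dom h' = dom h"
    "ran h' \<subseteq> carr N" "\<And>a. a \<in> F \<Longrightarrow> sat_par N h' a = sat_par M h a"
proof -
  have ne: "carr M \<noteq> {}" using M by (simp add: is_struct_def)
  then obtain c where c: "c \<in> carr M" by auto
  obtain K where K: "\<And>a. skolem_fns M a (K a)" using ex_skolem_fns[OF ne] by metis
  define S where "S = (\<Union>a \<in> F. set1_fm a)"
  \<comment> \<open>\<open>countable_hull\<close> applies its functions to lists of every length,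
    while \<open>is_struct\<close> controls \<open>fun_int\<close> only at the right arity.
    Elsewhere the value is set to \<open>c\<close>.\<close>
  define op where "op f as = (if fun_arity \<sigma> f = Some (length as) then fun_int M f as else c)" for f as
  \<comment> \<open>The constant functions force \<open>c\<close> and all values of \<open>h\<close>
    into the hull; the others provide Skolem functions and closure under the symbols of
    \<open>F\<close>.\<close>
  define L where "L = (\<Union>a \<in> F. K a) \<union> op ` S \<union> (\<lambda>c as. c) ` insert c (ran h)"
  have "finite (ran h)"
    using h(1) by (simp add: finite_ran)
  then have "finite L"
    using F(1) K by (auto simp: L_def S_def finite_set1_fm skolem_fns_def)
  then have "countable L" by (rule countable_finite)
  moreover have "k as \<in> carr M" if "k \<in> L" "set as \<subseteq> carr M" for k as
  proof -
    have "op f as \<in> carr M" for f using M c that(2) by (simp add: op_def is_struct_def)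
    then show ?thesis using that K c h(2) by (auto simp: L_def skolem_fns_def)
  qed
  moreover have "L \<noteq> {}" by (auto simp: L_def)
  ultimately obtain C where C: "countable C" "C \<subseteq> carr M"
    "\<And>k as. k \<in> L \<Longrightarrow> set as \<subseteq> C \<Longrightarrow> k as \<in> C"
    using countable_hull by metis
  have const: "d \<in> C" if "d \<in> insert c (ran h)" for d
  proof -
    have "(\<lambda>as. d) \<in> L" using that unfolding L_def by blast
    from C(3)[OF this, of "[]"] show ?thesis by simp
  qed
  obtain j :: "nat \<Rightarrow> 'e" where j: "inj j"
    using infinite_countable_subset[OF inf] by auto
  \<comment> \<open>The countable hull is numbered, and the numbers are embedded in the infinite
    type \<open>'e\<close>.\<close>
  define e where "e = j \<circ> to_nat_on C"
  have inj: "inj_on e C"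
    unfolding e_def
    by (rule comp_inj_on[OF inj_on_to_nat_on[OF C(1)] inj_on_subset[OF j subset_UNIV]])
  define d where "d = inv_into C e"
  have de: "map d (map e as) = as" if "set as \<subseteq> C" for as
    using that inj by (induction as) (auto simp: d_def)
  \<comment> \<open>Arguments are decoded by \<open>d\<close>, evaluated in \<open>M\<close>, and
    encoded again. A function symbol outside \<open>S\<close> is constant, since its values in
    \<open>M\<close> might leave the hull.\<close>
  define N :: "('f, 'r, 'e) struct" where "N = \<lparr>carr = e ` C,
    fun_int = (\<lambda>f bs. if f \<in> S then e (fun_int M f (map d bs)) else e c),
    rel_int = (\<lambda>r bs. rel_int M r (map d bs))\<rparr>"
  have closed: "fun_int M f as \<in> C"
    if "f \<in> S" "fun_arity \<sigma> f = Some (length as)" "set as \<subseteq> C" for f as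
  proof -
    have "op f \<in> L" using that(1) by (auto simp: L_def)
    from C(3)[OF this that(3)] show ?thesis using that(2) by (simp add: op_def)
  qed
  interpret embedding \<sigma> M C e S N
    by unfold_locales (use inj closed de in \<open>auto simp: N_def simp del: map_map\<close>)
  show ?thesis
  proof
    show "is_struct \<sigma> N"
      unfolding is_struct_def
    proof (intro conjI allI impI)
      show "carr N \<noteq> {}" using const by (auto simp: N_def)
      fix f bs assume f: "fun_arity \<sigma> f = Some (length bs) \<and> set bs \<subseteq> carr N"
      have "set (map d bs) \<subseteq> C"
        using f by (auto simp: N_def d_def intro!: inv_into_into)
      then have "fun_int M f (map d bs) \<in> C" if "f \<in> S"
        using closed[OF that, of "map d bs"] f by simp
      then show "fun_int N f bs \<in> carr N" using const by (auto simp: N_def)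
    qed
    show "dom (map_option e \<circ> h) = dom h" by (auto simp: dom_def)
    show "ran (map_option e \<circ> h) \<subseteq> carr N"
      using const by (auto simp: ran_def N_def)
    fix a assume a: "a \<in> F"
    let ?g = "join h Map.empty"
    have fv: "free_vars a \<subseteq> dom ?g"
    proof
      fix v assume "v \<in> free_vars a"
      then show "v \<in> dom ?g"
        using F(2)[OF a] by (cases v) (auto simp: FreeT_def FreeP_def)
    qed
    have ran: "ran ?g \<subseteq> C"
    proof
      fix y assume "y \<in> ran ?g"
      then obtain v where "?g v = Some y" by (auto simp: ran_def)
      then have "y \<in> ran h" by (cases v) (auto intro: ranI)
      then show "y \<in> C" using const by simp
    qed
    have "reflects M C a"
    proof (rule skolem_fnsD[OF K C(2)])
      show "\<forall>k \<in> K a. \<forall>as. set as \<subseteq> C \<longrightarrow> k as \<in> C"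
      proof (intro ballI allI impI)
        fix k as assume k: "k \<in> K a" "set as \<subseteq> C"
        have "k \<in> L" using k(1) a by (auto simp: L_def)
        then show "k as \<in> C" using k(2) by (rule C(3))
      qed
    qed
    then have "sat (M\<lparr>carr := C\<rparr>) ?g a = sat M ?g a"
      using ran fv by (simp add: reflects_def)
    moreover have "sat N (map_option e \<circ> ?g) a = sat (M\<lparr>carr := C\<rparr>) ?g a"
      by (rule sat_embedding[OF ran]) (use F(2)[OF a] fv a in \<open>auto simp: S_def\<close>)
    moreover have "join (map_option e \<circ> h) Map.empty = map_option e \<circ> ?g"
    proof
      fix v show "join (map_option e \<circ> h) Map.empty v = (map_option e \<circ> ?g) v"
        by (cases v) simp_all
    qed
    ultimately show "sat_par N (map_option e \<circ> h) a = sat_par M h a"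
      by (simp only: sat_par_def)
  qed
qed

section \<open>Renaming of team variables\<close>

lemma trm_val_ren_trm: "trm_val M g (ren_trm \<rho> t) = trm_val M (g \<circ> ren_var \<rho>) t"
  by (induction t) (auto cong: map_cong simp: comp_def)

lemma atom_sat_ren_atom: "atom_sat M g (ren_atom \<rho> a) = atom_sat M (g \<circ> ren_var \<rho>) a"
  by (cases a) (auto simp: trm_val_ren_trm comp_def)

text \<open>
  The alternative \<open>\<rho> x = x\<close> in the side condition keeps it stable under \<open>ren_bind\<close>: a quantifier on \<open>x\<close>
  may have further quantifiers on \<open>x\<close> in its scope.
\<close>

lemma sat_ren_fm:
  "(\<And>x. x \<in> FreeT a \<Longrightarrow> \<rho> x = x \<or> Team (\<rho> x) \<notin> bound_vars a) \<Longrightarrow>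
    sat M g (ren_fm \<rho> a) = sat M (g \<circ> ren_var \<rho>) a"
proof (induction a arbitrary: g \<rho>)
  \<comment> \<open>The two assignments could differ only if a free variable other than
    \<open>y\<close> were renamed to \<open>y\<close>, which is the capture that the side condition
    excludes.\<close>
  have bind: "sat M (g(y \<mapsto> u) \<circ> ren_var (ren_bind \<rho> y)) a = sat M ((g \<circ> ren_var \<rho>)(y \<mapsto> u)) a"
    if "\<And>x. Team x \<in> free_vars a - {y} \<Longrightarrow> \<rho> x = x \<or> Team (\<rho> x) \<notin> insert y (bound_vars a)"
    for g :: "var \<rightharpoonup> 'c" and y u \<rho> and a :: "('a, 'b) fm"
  proof (rule sat_cong)
    fix v assume v: "v \<in> free_vars a"
    show "(g(y \<mapsto> u) \<circ> ren_var (ren_bind \<rho> y)) v = ((g \<circ> ren_var \<rho>)(y \<mapsto> u)) v"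
    proof (cases v)
      case (Team x)
      then show ?thesis using v that[of x] by (cases y) auto
    qed (cases y; simp)
  qed
  have side: "ren_bind \<rho> y x = x \<or> Team (ren_bind \<rho> y x) \<notin> bound_vars a"
    if "\<And>x. Team x \<in> free_vars a - {y} \<Longrightarrow> \<rho> x = x \<or> Team (\<rho> x) \<notin> insert y (bound_vars a)"
      "x \<in> FreeT a"
    for \<rho> y x and a :: "('a, 'b) fm"
    using that by (cases y) (auto simp: FreeT_def)
  {
    case (Ex y a)
    then have c: "\<And>x. Team x \<in> free_vars a - {y} \<Longrightarrow> \<rho> x = x \<or> Team (\<rho> x) \<notin> insert y (bound_vars a)"
      by (auto simp: FreeT_def)
    show ?case
      by (simp only: ren_fm.simps sat.simps Ex.IH[OF side[OF c]] bind[OF c])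
  }
  {
    case (All y a)
    then have c: "\<And>x. Team x \<in> free_vars a - {y} \<Longrightarrow> \<rho> x = x \<or> Team (\<rho> x) \<notin> insert y (bound_vars a)"
      by (auto simp: FreeT_def)
    show ?case
      by (simp only: ren_fm.simps sat.simps All.IH[OF side[OF c]] bind[OF c])
  }
  {
    case (Con a b)
    have "sat M g (ren_fm \<rho> a) = sat M (g \<circ> ren_var \<rho>) a"
      by (rule Con.IH(1)) (use Con.prems in \<open>auto simp: FreeT_def\<close>)
    moreover have "sat M g (ren_fm \<rho> b) = sat M (g \<circ> ren_var \<rho>) b"
      by (rule Con.IH(2)) (use Con.prems in \<open>auto simp: FreeT_def\<close>)
    ultimately show ?case by (simp only: ren_fm.simps sat.simps)
  }
  {
    case (Dis a b)
    have "sat M g (ren_fm \<rho> a) = sat M (g \<circ> ren_var \<rho>) a"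
      by (rule Dis.IH(1)) (use Dis.prems in \<open>auto simp: FreeT_def\<close>)
    moreover have "sat M g (ren_fm \<rho> b) = sat M (g \<circ> ren_var \<rho>) b"
      by (rule Dis.IH(2)) (use Dis.prems in \<open>auto simp: FreeT_def\<close>)
    ultimately show ?case by (simp only: ren_fm.simps sat.simps)
  }
  {
    case (Neg a)
    then show ?case by (auto simp: FreeT_def)
  }
qed (simp add: atom_sat_ren_atom)

lemma trm_vars_ren_trm: "trm_vars (ren_trm \<rho> t) = ren_var \<rho> ` trm_vars t"
  by (induction t) auto

lemma free_vars_ren_fm: "free_vars (ren_fm \<rho> a) \<subseteq> ren_var \<rho> ` free_vars a"
proof (induction a arbitrary: \<rho>)
  have bind: "ren_var (ren_bind \<rho> y) ` A - {y} \<subseteq> ren_var \<rho> ` (A - {y})" for \<rho> y A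
  proof
    fix v assume "v \<in> ren_var (ren_bind \<rho> y) ` A - {y}"
    then obtain w where w: "w \<in> A" "v = ren_var (ren_bind \<rho> y) w" "v \<noteq> y" by auto
    then have "w \<noteq> y" "v = ren_var \<rho> w" by (cases y; cases w; auto split: if_splits)+
    then show "v \<in> ren_var \<rho> ` (A - {y})" using w by auto
  qed
  {
    case (Atom a)
    then show ?case by (cases a) (auto simp: trm_vars_ren_trm)
  }
  {
    case (Ex y a)
    then show ?case using bind[of \<rho> y "free_vars a"] by fastforce
  }
  {
    case (All y a)
    then show ?case using bind[of \<rho> y "free_vars a"] by fastforce
  }
qed fastforce+

lemma wf_ren_trm: "wf_trm \<sigma> (ren_trm \<rho> t) = wf_trm \<sigma> t"
  by (induction t) auto

lemma wf_ren_fm: "wf_fm \<sigma> (ren_fm \<rho> a) = wf_fm \<sigma> a"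
proof (induction a arbitrary: \<rho>)
  case (Atom a)
  then show ?case by (cases a) (auto simp: wf_ren_trm)
qed auto

section \<open>The formula of PS-ind\<close>

lemma finite_ind_vars: "finite (ind_vars \<gamma> t1 t2 t3)"
proof -
  have "{x. Team x \<in> (\<Union>t \<in> set (t1 @ t2 @ t3). trm_vars t)} =
    Team -` (\<Union>t \<in> set (t1 @ t2 @ t3). trm_vars t)" by auto
  moreover have "finite (Team -` (\<Union>t \<in> set (t1 @ t2 @ t3). trm_vars t))"
    by (rule finite_vimageI) (auto simp: finite_trm_vars inj_def)
  ultimately show ?thesis by (simp add: ind_vars_def finite_FreeT)
qed

lemma wf_ind_fm:
  assumes "wf_fm \<sigma> \<gamma>" "\<forall>t \<in> set (t1 @ t2 @ t3). wf_trm \<sigma> t"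
  shows "wf_fm \<sigma> (ind_fm \<rho>1 \<rho>2 \<rho>3 \<gamma> t1 t2 t3)"
proof -
  have w: "wf_fm \<sigma> (tuple_eq (map (ren_trm \<rho>) ts) (map (ren_trm \<rho>') ts))"
    if "set ts \<subseteq> set (t1 @ t2 @ t3)" for \<rho> \<rho>' ts
    using that assms(2) by (intro wf_tuple_eq) (auto simp: wf_ren_trm)
  have "wf_fm \<sigma> (tuple_eq (map (ren_trm \<rho>) t1) (map (ren_trm \<rho>') t1))"
    "wf_fm \<sigma> (tuple_eq (map (ren_trm \<rho>) (t1 @ t2)) (map (ren_trm \<rho>') (t1 @ t2)))"
    "wf_fm \<sigma> (tuple_eq (map (ren_trm \<rho>) (t1 @ t3)) (map (ren_trm \<rho>') (t1 @ t3)))" for \<rho> \<rho>'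
    by (rule w, force)+
  then show ?thesis
    using assms(1)
    by (simp add: ind_fm_def Let_def wf_forallsT wf_existsT wf_ren_fm del: map_append)
qed

lemma inj_Team: "inj Team"
  by (simp add: inj_def)

text \<open>The free team variables of each renamed copy lie in the image of \<open>ind_vars\<close>
  under its renaming, and these images are exactly what the quantifier blocks bind.\<close>

lemma FreeT_ind_fm:
  fixes \<gamma> :: "('f, 'r) fm"
  shows "FreeT (ind_fm \<rho>1 \<rho>2 \<rho>3 \<gamma> t1 t2 t3) = {}"
proof -
  let ?eq = "tuple_eq :: 'f trm list \<Rightarrow> 'f trm list \<Rightarrow> ('f, 'r) fm"
  let ?V = "ind_vars \<gamma> t1 t2 t3"
  have 1: "x \<in> \<rho> ` ?V" if x: "Team x \<in> free_vars (ren_fm \<rho> \<gamma>)" for x \<rho>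
  proof -
    obtain v where "v \<in> free_vars \<gamma>" "Team x = ren_var \<rho> v"
      using subsetD[OF free_vars_ren_fm x] by auto
    then show ?thesis by (cases v) (auto simp: ind_vars_def FreeT_def)
  qed
  have 2: "x \<in> \<rho> ` ?V \<union> \<rho>' ` ?V"
    if x: "Team x \<in> free_vars (?eq (map (ren_trm \<rho>) ts) (map (ren_trm \<rho>') ts))"
      and ts: "set ts \<subseteq> set (t1 @ t2 @ t3)" for x \<rho> \<rho>' ts
  proof -
    have "Team x \<in> (\<Union>t \<in> set ts. ren_var \<rho> ` trm_vars t \<union> ren_var \<rho>' ` trm_vars t)"
      using subsetD[OF free_vars_tuple_eq x] by (auto simp: trm_vars_ren_trm)
    then obtain t v where t: "t \<in> set ts" "v \<in> trm_vars t"
      and v: "Team x = ren_var \<rho> v \<or> Team x = ren_var \<rho>' v" by auto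
    from v obtain y where y: "v = Team y" "x = \<rho> y \<or> x = \<rho>' y" by (cases v) auto
    have "y \<in> ?V" using t y ts unfolding ind_vars_def by blast
    then show ?thesis using y by auto
  qed
  have 3: "Team x \<in> free_vars (?eq (map (ren_trm \<rho>) t1) (map (ren_trm \<rho>') t1)) \<Longrightarrow>
      x \<in> \<rho> ` ?V \<union> \<rho>' ` ?V"
    "Team x \<in> free_vars (?eq (map (ren_trm \<rho>) (t1 @ t2)) (map (ren_trm \<rho>') (t1 @ t2))) \<Longrightarrow>
      x \<in> \<rho> ` ?V \<union> \<rho>' ` ?V"
    "Team x \<in> free_vars (?eq (map (ren_trm \<rho>) (t1 @ t3)) (map (ren_trm \<rho>') (t1 @ t3))) \<Longrightarrow>
      x \<in> \<rho> ` ?V \<union> \<rho>' ` ?V" for x \<rho> \<rho>'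
    by (erule 2, force)+
  show ?thesis
  proof (rule equals0I)
    fix x assume "x \<in> FreeT (ind_fm \<rho>1 \<rho>2 \<rho>3 \<gamma> t1 t2 t3)"
    then have "x \<notin> \<rho>1 ` ?V" "x \<notin> \<rho>2 ` ?V"
      and "Team x \<in> free_vars (ren_fm \<rho>1 \<gamma>) \<or> Team x \<in> free_vars (ren_fm \<rho>2 \<gamma>) \<or>
        Team x \<in> free_vars (?eq (map (ren_trm \<rho>1) t1) (map (ren_trm \<rho>2) t1)) \<or>
        x \<notin> \<rho>3 ` ?V \<and> (Team x \<in> free_vars (ren_fm \<rho>3 \<gamma>) \<or>
          Team x \<in> free_vars (?eq (map (ren_trm \<rho>3) (t1 @ t2)) (map (ren_trm \<rho>1) (t1 @ t2))) \<or>
          Team x \<in> free_vars (?eq (map (ren_trm \<rho>3) (t1 @ t3)) (map (ren_trm \<rho>2) (t1 @ t3))))"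
      unfolding FreeT_def ind_fm_def Let_def free_vars_forallsT free_vars.simps free_vars_existsT
        set_append set_map set_sorted_list_of_set[OF finite_ind_vars] mem_Collect_eq Diff_iff Un_iff
        inj_image_mem_iff[OF inj_Team]
      by blast+
    then show False
      using 1[of x \<rho>1] 1[of x \<rho>2] 1[of x \<rho>3] 3(1)[of x \<rho>1 \<rho>2] 3(2)[of x \<rho>3 \<rho>1] 3(3)[of x \<rho>3 \<rho>2]
      by (elim disjE conjE) (simp_all only: Un_iff, blast+)
  qed
qed

text \<open>The two given assignments are placed on the first and second copy of the variables, and
  the third is read off from the witnesses for the third copy. Disjointness of the copies lets all
  three coexist in one assignment.\<close>

lemma ind_fm_sound:
  fixes M :: "('f, 'r, 'u) struct"
  assumes ne: "carr M \<noteq> {}"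
    and sat: "sat_par M h (ind_fm \<rho>1 \<rho>2 \<rho>3 \<gamma> t1 t2 t3)"
    and fresh: "fresh_copies (ind_vars \<gamma> t1 t2 t3) \<gamma> \<rho>1 \<rho>2 \<rho>3"
    and par: "ifree_vars (Ind t1 t2 t3 :: ('f, 'r) ifm) \<subseteq> range Team"
  shows "ent_sat \<sigma> M (Ind t1 t2 t3) \<gamma> h"
  unfolding ent_sat_Ind_iff[OF ne] ind_team_def Let_def
proof (intro ballI impI)
  fix u u'
  assume "u \<in> team M h \<gamma>" "u' \<in> team M h \<gamma>"
  then have u: "range u \<subseteq> carr M" "sat M (tot h u) \<gamma>" and u': "range u' \<subseteq> carr M" "sat M (tot h u') \<gamma>"
    by (simp_all add: team_def)
  assume eq: "map (trm_val M (tot Map.empty u)) t1 = map (trm_val M (tot Map.empty u')) t1"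
  define V where "V = ind_vars \<gamma> t1 t2 t3"
  have V: "set (sorted_list_of_set (ind_vars \<gamma> t1 t2 t3)) = V"
    by (simp add: V_def finite_ind_vars)
  have FV: "FreeT \<gamma> \<subseteq> V" by (auto simp: V_def ind_vars_def)
  have fr: "inj_on \<rho>1 V" "inj_on \<rho>2 V" "inj_on \<rho>3 V"
    "\<rho>1 ` V \<inter> \<rho>2 ` V = {}" "\<rho>1 ` V \<inter> \<rho>3 ` V = {}" "\<rho>2 ` V \<inter> \<rho>3 ` V = {}"
    "(\<rho>1 ` V \<union> \<rho>2 ` V \<union> \<rho>3 ` V) \<inter> {x. Team x \<in> bound_vars \<gamma>} = {}"
    using fresh unfolding fresh_copies_def V_def by auto
  have ren: "sat M g (ren_fm \<rho> \<gamma>) = sat M (tot h w) \<gamma>"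
    if "\<rho> \<in> {\<rho>1, \<rho>2, \<rho>3}" "\<And>p. g (Par p) = h p" "\<And>x. x \<in> V \<Longrightarrow> g (Team (\<rho> x)) = Some (w x)"
    for g \<rho> w
  proof -
    have "sat M g (ren_fm \<rho> \<gamma>) = sat M (g \<circ> ren_var \<rho>) \<gamma>"
      by (rule sat_ren_fm) (use that(1) fr(7) FV in blast)
    also have "\<dots> = sat M (tot h w) \<gamma>"
    proof (rule sat_cong)
      fix v assume "v \<in> free_vars \<gamma>"
      then show "(g \<circ> ren_var \<rho>) v = tot h w v"
        using that FV by (cases v) (auto simp: FreeT_def)
    qed
    finally show ?thesis .
  qed
  \<comment> \<open>The tuples contain no parameters, so it does not matter that
    \<open>tot Map.empty w\<close> forgets \<open>h\<close>.\<close>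
  have tv: "map (trm_val M g) (map (ren_trm \<rho>) ts) = map (trm_val M (tot Map.empty w)) ts"
    if "set ts \<subseteq> set (t1 @ t2 @ t3)" "\<And>x. x \<in> V \<Longrightarrow> g (Team (\<rho> x)) = Some (w x)"
    for g \<rho> w and ts
    unfolding map_map
  proof (rule map_cong[OF refl])
    fix t assume t: "t \<in> set ts"
    have "trm_val M (g \<circ> ren_var \<rho>) t = trm_val M (tot Map.empty w) t"
    proof (rule trm_val_cong)
      fix v assume v: "v \<in> trm_vars t"
      then have "v \<in> ifree_vars (Ind t1 t2 t3 :: ('f, 'r) ifm)" using t that(1) by auto
      then obtain x where x: "v = Team x" using par by auto
      then have "x \<in> V" using v t that(1) unfolding V_def ind_vars_def by blast
      then show "(g \<circ> ren_var \<rho>) v = tot Map.empty w v" using that(2) x by simp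
    qed
    then show "(trm_val M g \<circ> ren_trm \<rho>) t = trm_val M (tot Map.empty w) t"
      by (simp add: trm_val_ren_trm)
  qed
  \<comment> \<open>Each copy is decoded by inverting its renaming on \<open>V\<close>; since the
    two images are disjoint, the case distinction gives \<open>u'\<close> on the whole second
    copy.\<close>
  define w where "w y = (if y \<in> \<rho>1 ` V then u (inv_into V \<rho>1 y) else u' (inv_into V \<rho>2 y))" for y
  define G where "G = team_upd (join h Map.empty) (\<rho>1 ` V \<union> \<rho>2 ` V) w"
  have G: "\<And>p. G (Par p) = h p" by (simp add: G_def)
  have G1: "G (Team (\<rho>1 x)) = Some (u x)" if "x \<in> V" for x
    using that fr(1) by (simp add: G_def w_def)
  have G2: "G (Team (\<rho>2 x)) = Some (u' x)" if "x \<in> V" for x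
  proof -
    have "\<rho>2 x \<notin> \<rho>1 ` V" using that fr(4) by blast
    then show ?thesis using that fr(2) by (simp add: G_def w_def)
  qed
  have "\<forall>y \<in> \<rho>1 ` V \<union> \<rho>2 ` V. w y \<in> carr M"
    using u(1) u'(1) by (auto simp: w_def)
  then have "sat M G (Imp (Con (ren_fm \<rho>1 \<gamma>) (Con (ren_fm \<rho>2 \<gamma>)
        (tuple_eq (map (ren_trm \<rho>1) t1) (map (ren_trm \<rho>2) t1))))
      (existsT (map \<rho>3 (sorted_list_of_set (ind_vars \<gamma> t1 t2 t3)))
        (Con (ren_fm \<rho>3 \<gamma>)
          (Con (tuple_eq (map (ren_trm \<rho>3) (t1 @ t2)) (map (ren_trm \<rho>1) (t1 @ t2)))
               (tuple_eq (map (ren_trm \<rho>3) (t1 @ t3)) (map (ren_trm \<rho>2) (t1 @ t3)))))))"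
    using sat unfolding sat_par_def ind_fm_def Let_def sat_forallsT set_append set_map V G_def
    by blast
  moreover have "sat M G (ren_fm \<rho>1 \<gamma>)" using ren[of \<rho>1 G u] G G1 u(2) by simp
  moreover have "sat M G (ren_fm \<rho>2 \<gamma>)" using ren[of \<rho>2 G u'] G G2 u'(2) by simp
  moreover have "sat M G (tuple_eq (map (ren_trm \<rho>1) t1) (map (ren_trm \<rho>2) t1))"
    using tv[of t1 G \<rho>1 u] tv[of t1 G \<rho>2 u'] G1 G2 eq by (subst sat_tuple_eq) auto
  ultimately have "sat M G (existsT (map \<rho>3 (sorted_list_of_set (ind_vars \<gamma> t1 t2 t3)))
        (Con (ren_fm \<rho>3 \<gamma>)
          (Con (tuple_eq (map (ren_trm \<rho>3) (t1 @ t2)) (map (ren_trm \<rho>1) (t1 @ t2)))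
               (tuple_eq (map (ren_trm \<rho>3) (t1 @ t3)) (map (ren_trm \<rho>2) (t1 @ t3))))))"
    by simp
  then obtain w3 where w3: "\<forall>y \<in> \<rho>3 ` V. w3 y \<in> carr M"
    and sat3: "sat M (team_upd G (\<rho>3 ` V) w3) (Con (ren_fm \<rho>3 \<gamma>)
          (Con (tuple_eq (map (ren_trm \<rho>3) (t1 @ t2)) (map (ren_trm \<rho>1) (t1 @ t2)))
               (tuple_eq (map (ren_trm \<rho>3) (t1 @ t3)) (map (ren_trm \<rho>2) (t1 @ t3)))))"
    unfolding sat_existsT set_map V by blast
  define G' where "G' = team_upd G (\<rho>3 ` V) w3"
  \<comment> \<open>Outside \<open>V\<close> the values are borrowed from \<open>u\<close> to stay
    in the carrier; neither \<open>\<gamma>\<close> nor the tuples look there.\<close>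
  define u'' where "u'' x = (if x \<in> V then w3 (\<rho>3 x) else u x)" for x
  have G': "\<And>p. G' (Par p) = h p" by (simp add: G'_def G)
  have G'1: "G' (Team (\<rho>1 x)) = Some (u x)" if "x \<in> V" for x
  proof -
    have "\<rho>1 x \<notin> \<rho>3 ` V" using that fr(5) by blast
    then show ?thesis using G1[OF that] by (simp add: G'_def)
  qed
  have G'2: "G' (Team (\<rho>2 x)) = Some (u' x)" if "x \<in> V" for x
  proof -
    have "\<rho>2 x \<notin> \<rho>3 ` V" using that fr(6) by blast
    then show ?thesis using G2[OF that] by (simp add: G'_def)
  qed
  have G'3: "G' (Team (\<rho>3 x)) = Some (u'' x)" if "x \<in> V" for x
    using that by (simp add: G'_def u''_def)
  have "range u'' \<subseteq> carr M" using u(1) w3 by (auto simp: u''_def)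
  moreover have "sat M (tot h u'') \<gamma>"
    using sat3 ren[of \<rho>3 G' u''] G' G'3 by (simp add: G'_def)
  moreover have "map (trm_val M (tot Map.empty u'')) (t1 @ t2) =
      map (trm_val M (tot Map.empty u)) (t1 @ t2)"
  proof -
    have "sat M G' (tuple_eq (map (ren_trm \<rho>3) (t1 @ t2)) (map (ren_trm \<rho>1) (t1 @ t2)))"
      using sat3 unfolding G'_def sat.simps by blast
    then have "map (trm_val M G') (map (ren_trm \<rho>3) (t1 @ t2)) =
        map (trm_val M G') (map (ren_trm \<rho>1) (t1 @ t2))"
      by (subst (asm) sat_tuple_eq) simp_all
    moreover have "map (trm_val M G') (map (ren_trm \<rho>3) (t1 @ t2)) =
        map (trm_val M (tot Map.empty u'')) (t1 @ t2)"
      by (rule tv) (auto simp: G'3)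
    moreover have "map (trm_val M G') (map (ren_trm \<rho>1) (t1 @ t2)) =
        map (trm_val M (tot Map.empty u)) (t1 @ t2)"
      by (rule tv) (auto simp: G'1)
    ultimately show ?thesis by metis
  qed
  moreover have "map (trm_val M (tot Map.empty u'')) (t1 @ t3) =
      map (trm_val M (tot Map.empty u')) (t1 @ t3)"
  proof -
    have "sat M G' (tuple_eq (map (ren_trm \<rho>3) (t1 @ t3)) (map (ren_trm \<rho>2) (t1 @ t3)))"
      using sat3 unfolding G'_def sat.simps by blast
    then have "map (trm_val M G') (map (ren_trm \<rho>3) (t1 @ t3)) =
        map (trm_val M G') (map (ren_trm \<rho>2) (t1 @ t3))"
      by (subst (asm) sat_tuple_eq) simp_all
    moreover have "map (trm_val M G') (map (ren_trm \<rho>3) (t1 @ t3)) =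
        map (trm_val M (tot Map.empty u'')) (t1 @ t3)"
      by (rule tv) (auto simp: G'3)
    moreover have "map (trm_val M G') (map (ren_trm \<rho>2) (t1 @ t3)) =
        map (trm_val M (tot Map.empty u')) (t1 @ t3)"
      by (rule tv) (auto simp: G'2)
    ultimately show ?thesis by metis
  qed
  ultimately show "\<exists>u'' \<in> team M h \<gamma>.
        map (trm_val M (tot Map.empty u'')) (t1 @ t2) = map (trm_val M (tot Map.empty u)) (t1 @ t2) \<and>
        map (trm_val M (tot Map.empty u'')) (t1 @ t3) = map (trm_val M (tot Map.empty u')) (t1 @ t3)"
    unfolding team_def by (intro bexI[of _ u'']) simp_all
qed

section \<open>Soundness\<close>

text \<open>\<open>infer\<close> does not demand well-formed premises, so this invariant is carried
  along the proof. It yields \<open>fm_over\<close> for the witnesses in PS-dis, PS-ex and PS-all,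
  and for PS-ent the finiteness and absence of free team variables that Loewenheim-Skolem
  requires.\<close>

fun wf_seq :: "('f, 'r) signature \<Rightarrow> ('f, 'r) sequent \<Rightarrow> bool" where
  "wf_seq \<sigma> (\<Gamma>, \<gamma>, \<phi>) \<longleftrightarrow> wf_ctx \<sigma> \<Gamma> \<and> wf_fm \<sigma> \<gamma>"

fun valid_ext :: "'u itself \<Rightarrow> ('f, 'r) signature \<Rightarrow> ('f, 'r) sequent \<Rightarrow> bool" where
  "valid_ext U \<sigma> (\<Gamma>, \<gamma>, \<phi>) \<longleftrightarrow>
     (\<forall>(M :: ('f, 'r, 'u) struct) h.
        is_struct \<sigma> M \<and> finite (dom h) \<and> FreeP_set \<Gamma> \<union> FreeP \<gamma> \<subseteq> dom h \<and> ran h \<subseteq> carr M \<and>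
        (\<forall>a \<in> \<Gamma>. sat_par M h a) \<longrightarrow> ent_sat \<sigma> M \<phi> \<gamma> h)"

lemma FreeP_simps:
  "FreeP (Neg a) = FreeP a"
  "FreeP (Con a b) = FreeP a \<union> FreeP b"
  "FreeP (Dis a b) = FreeP a \<union> FreeP b"
  "FreeP (Ex (Team x) a) = FreeP a"
  "FreeP (Ex (Par p) a) = FreeP a - {p}"
  "FreeP (conjs as) = FreeP_set (set as)"
  by (auto simp: FreeP_def FreeP_set_def free_vars_conjs)

lemma FreeP_set_simps:
  "FreeP_set (A \<union> B) = FreeP_set A \<union> FreeP_set B"
  "FreeP_set (insert a A) = FreeP a \<union> FreeP_set A"
  "FreeP_set {} = {}"
  by (auto simp: FreeP_set_def)

lemma finite_FreeP_set: "finite \<Gamma> \<Longrightarrow> finite (FreeP_set \<Gamma>)"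
  by (simp add: FreeP_set_def finite_FreeP)

lemma infer_wf:
  assumes "infer E \<sigma> Ss S" "\<forall>S \<in> set Ss. wf_seq \<sigma> S"
  shows "wf_seq \<sigma> S"
  using assms
proof (induction rule: infer.induct)
  case (PS_ind \<gamma> t1 t2 t3 \<rho>1 \<rho>2 \<rho>3)
  then show ?case
    by (simp add: wf_ctx_def wf_ifm_def FreeT_ind_fm wf_ind_fm)
next
  case (PS_lit \<gamma> l)
  then show ?case by (simp add: wf_ctx_def wf_closeT FreeT_closeT wf_ifm_def)
next
  case (PS_depar p \<gamma> gs \<Gamma> \<phi>)
  then show ?case
    by (auto simp: wf_ctx_def FreeT_def free_vars_conjs intro!: wf_conjs)
next
  case (PS_split gs1 \<Gamma>1 gs2 \<Gamma>2 \<gamma> \<phi>)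
  then show ?case
    by (auto simp: wf_ctx_def FreeT_def free_vars_conjs intro!: wf_conjs)
qed (auto simp: wf_ctx_def wf_closeT FreeT_closeT)

text \<open>A structure over \<open>'e\<close> that agrees with \<open>M\<close> on the finitely
  many formulas of both contexts carries the hypothesis over to \<open>'e\<close>, where
  \<open>entails\<close> applies, and the conclusion back.\<close>

lemma PS_ent_sound:
  fixes \<Gamma> \<Gamma>' :: "('f, 'r) fm set" and M :: "('f, 'r, 'u) struct"
  assumes inf: "infinite (UNIV :: 'e set)"
    and wf: "wf_ctx \<sigma> \<Gamma>" "wf_ctx \<sigma> \<Gamma>'"
    and ent: "entails TYPE('e) \<sigma> \<Gamma>' \<Gamma>"
    and M: "is_struct \<sigma> M"
    and h: "finite (dom h)" "FreeP_set \<Gamma>' \<union> FreeP_set \<Gamma> \<subseteq> dom h" "ran h \<subseteq> carr M"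
    and sat: "\<forall>a \<in> \<Gamma>'. sat_par M h a"
  shows "\<forall>a \<in> \<Gamma>. sat_par M h a"
proof -
  \<comment> \<open>\<open>entails\<close> speaks only of assignments with exactly this
    domain.\<close>
  let ?h = "h |` (FreeP_set \<Gamma>' \<union> FreeP_set \<Gamma>)"
  have dom: "dom ?h = FreeP_set \<Gamma>' \<union> FreeP_set \<Gamma>" using h(2) by auto
  have eq: "sat_par M ?h a = sat_par M h a" if "a \<in> \<Gamma>' \<union> \<Gamma>" for a
    by (rule sat_par_cong) (use that in \<open>auto simp: FreeP_set_def restrict_map_def\<close>)
  obtain N :: "('f, 'r, 'e) struct" and h' where N: "is_struct \<sigma> N" "dom h' = dom ?h"
    "ran h' \<subseteq> carr N" "\<And>a. a \<in> \<Gamma>' \<union> \<Gamma> \<Longrightarrow> sat_par N h' a = sat_par M ?h a"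
  proof (rule downward_loewenheim_skolem[OF inf M, of "\<Gamma>' \<union> \<Gamma>" ?h])
    show "finite (\<Gamma>' \<union> \<Gamma>)" using wf by (simp add: wf_ctx_def)
    show "wf_fm \<sigma> a \<and> FreeT a = {} \<and> FreeP a \<subseteq> dom ?h" if "a \<in> \<Gamma>' \<union> \<Gamma>" for a
      using that wf unfolding dom by (auto simp: wf_ctx_def FreeP_set_def)
    show "finite (dom ?h)" using h(1) by simp
    show "ran ?h \<subseteq> carr M" using h(3) by (auto simp: ran_def restrict_map_def split: if_splits)
  qed blast
  then have "\<forall>a \<in> \<Gamma>'. sat_par N h' a" using sat eq by simp
  then have "\<forall>a \<in> \<Gamma>. sat_par N h' a"
    using ent N(1-3) dom unfolding entails_def by metis
  then show ?thesis using N(4) eq by simp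
qed

text \<open>In PS-dis, PS-ex and PS-all, \<open>h\<close> itself is the extension that the semantics
  asks for, and the first-order formulas of the premises are the witnesses. PS-ent and PS-depar
  apply the premise to a modified assignment and return to \<open>h\<close> by
  \<open>ent_sat_team_cong\<close>.\<close>

lemma infer_sound:
  fixes \<sigma> :: "('f, 'r) signature"
  assumes "infer TYPE('e) \<sigma> Ss S" "infinite (UNIV :: 'e set)"
    and "\<forall>S \<in> set Ss. wf_seq \<sigma> S \<and> valid_ext TYPE('u) \<sigma> S"
  shows "valid_ext TYPE('u) \<sigma> S"
  using assms
proof (induction rule: infer.induct)
  case (PS_lit \<gamma> l)
  show ?case
    unfolding valid_ext.simps
  proof (intro allI impI, elim conjE)
    fix M :: "('f, 'r, 'u) struct" and h
    assume "is_struct \<sigma> M" and sat: "\<forall>a \<in> {closeT (Imp \<gamma> (lit_fm l))}. sat_par M h a"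
    then have ne: "carr M \<noteq> {}" by (simp add: is_struct_def)
    \<comment> \<open>The closure evaluates the literal with \<open>h\<close>, the semantics without
      it; the literal has no parameters, so both agree.\<close>
    have "sat M (tot h u) (lit_fm l) = sat M (tot Map.empty u) (lit_fm l)" for u
      by (rule sat_tot_cong) (use PS_lit(2) in \<open>auto simp: wf_ifm_def FreeP_def\<close>)
    then show "ent_sat \<sigma> M (Lit l) \<gamma> h"
      using sat unfolding ent_sat_Lit_iff[OF ne] by (auto simp: sat_closeT[OF ne])
  qed
next
  case (PS_ind \<gamma> t1 t2 t3 \<rho>1 \<rho>2 \<rho>3)
  show ?case
    unfolding valid_ext.simps
  proof (intro allI impI, elim conjE)
    fix M :: "('f, 'r, 'u) struct" and h
    assume "is_struct \<sigma> M" "\<forall>a \<in> {ind_fm \<rho>1 \<rho>2 \<rho>3 \<gamma> t1 t2 t3}. sat_par M h a"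
    then show "ent_sat \<sigma> M (Ind t1 t2 t3) \<gamma> h"
      using PS_ind(2,3) by (intro ind_fm_sound) (auto simp: is_struct_def wf_ifm_def)
  qed
next
  case (PS_dis \<gamma> \<Gamma>1 \<gamma>1 \<phi>1 \<Gamma>2 \<gamma>2 \<phi>2)
  show ?case
    unfolding valid_ext.simps
  proof (intro allI impI, elim conjE)
    fix M :: "('f, 'r, 'u) struct" and h
    assume a: "is_struct \<sigma> M" "finite (dom h)" "ran h \<subseteq> carr M"
      "FreeP_set (\<Gamma>1 \<union> \<Gamma>2 \<union> {closeT (Iff \<gamma> (Dis \<gamma>1 \<gamma>2))}) \<union> FreeP \<gamma> \<subseteq> dom h"
      "\<forall>a \<in> \<Gamma>1 \<union> \<Gamma>2 \<union> {closeT (Iff \<gamma> (Dis \<gamma>1 \<gamma>2))}. sat_par M h a"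
    \<comment> \<open>\<open>closeT\<close> binds team variables only, so the parameters of
      \<open>\<gamma>1\<close> and \<open>\<gamma>2\<close> still occur in the added formula and
      \<open>h\<close> covers both premises.\<close>
    then have d: "FreeP_set \<Gamma>1 \<union> FreeP \<gamma>1 \<subseteq> dom h" "FreeP_set \<Gamma>2 \<union> FreeP \<gamma>2 \<subseteq> dom h"
      by (auto simp: FreeP_set_simps FreeP_simps FreeP_closeT)
    have "ent_sat \<sigma> M \<phi>1 \<gamma>1 h" "ent_sat \<sigma> M \<phi>2 \<gamma>2 h"
      using PS_dis a d by auto
    moreover have "par_ext M h h" "fm_over \<sigma> h \<gamma>1" "fm_over \<sigma> h \<gamma>2"
      using PS_dis a d by (auto simp: par_ext_def fm_over_def)
    moreover have "sat_par M h (closeT (Iff \<gamma> (Dis \<gamma>1 \<gamma>2)))" using a by blast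
    ultimately show "ent_sat \<sigma> M (IDis \<phi>1 \<phi>2) \<gamma> h" unfolding ent_sat.simps by blast
  qed
next
  case (PS_con \<Gamma>1 \<gamma> \<phi>1 \<Gamma>2 \<phi>2)
  then show ?case by (auto simp: FreeP_set_simps)
next
  case (PS_ex \<gamma> \<Gamma> \<gamma>' \<phi> x)
  show ?case
    unfolding valid_ext.simps
  proof (intro allI impI, elim conjE)
    fix M :: "('f, 'r, 'u) struct" and h
    let ?c = "closeT (Iff (Ex (Team x) \<gamma>') (Ex (Team x) \<gamma>))"
    assume a: "is_struct \<sigma> M" "finite (dom h)" "ran h \<subseteq> carr M"
      "FreeP_set (\<Gamma> \<union> {?c}) \<union> FreeP \<gamma> \<subseteq> dom h" "\<forall>a \<in> \<Gamma> \<union> {?c}. sat_par M h a"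
    then have d: "FreeP_set \<Gamma> \<union> FreeP \<gamma>' \<subseteq> dom h"
      by (auto simp: FreeP_set_simps FreeP_simps FreeP_closeT)
    have "ent_sat \<sigma> M \<phi> \<gamma>' h" using PS_ex a d by auto
    moreover have "par_ext M h h" "fm_over \<sigma> h \<gamma>'"
      using PS_ex a d by (auto simp: par_ext_def fm_over_def)
    moreover have "sat_par M h ?c" using a by blast
    ultimately show "ent_sat \<sigma> M (IEx x \<phi>) \<gamma> h" unfolding ent_sat.simps by blast
  qed
next
  case (PS_all \<gamma> \<Gamma> \<gamma>' \<phi> x)
  show ?case
    unfolding valid_ext.simps
  proof (intro allI impI, elim conjE)
    fix M :: "('f, 'r, 'u) struct" and h
    let ?c = "closeT (Iff \<gamma>' (Ex (Team x) \<gamma>))"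
    assume a: "is_struct \<sigma> M" "finite (dom h)" "ran h \<subseteq> carr M"
      "FreeP_set (\<Gamma> \<union> {?c}) \<union> FreeP \<gamma> \<subseteq> dom h" "\<forall>a \<in> \<Gamma> \<union> {?c}. sat_par M h a"
    then have d: "FreeP_set \<Gamma> \<union> FreeP \<gamma>' \<subseteq> dom h"
      by (auto simp: FreeP_set_simps FreeP_simps FreeP_closeT)
    have "ent_sat \<sigma> M \<phi> \<gamma>' h" using PS_all a d by auto
    moreover have "par_ext M h h" "fm_over \<sigma> h \<gamma>'"
      using PS_all a d by (auto simp: par_ext_def fm_over_def)
    moreover have "sat_par M h ?c" using a by blast
    ultimately show "ent_sat \<sigma> M (IAll x \<phi>) \<gamma> h" unfolding ent_sat.simps by blast
  qed
next
  case (PS_ent \<Gamma>' \<Gamma> \<gamma> \<phi>)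
  have wf: "wf_ctx \<sigma> \<Gamma>" using PS_ent by auto
  show ?case
    unfolding valid_ext.simps
  proof (intro allI impI, elim conjE)
    fix M :: "('f, 'r, 'u) struct" and h
    assume M: "is_struct \<sigma> M" and h: "finite (dom h)" "ran h \<subseteq> carr M"
      "FreeP_set \<Gamma>' \<union> FreeP \<gamma> \<subseteq> dom h" and sat: "\<forall>a \<in> \<Gamma>'. sat_par M h a"
    then have ne: "carr M \<noteq> {}" by (simp add: is_struct_def)
    then obtain c where c: "c \<in> carr M" by auto
    \<comment> \<open>\<open>\<Gamma>\<close> may contain parameters on which \<open>h\<close> is
      undefined; they get the arbitrary value \<open>c\<close>. In \<open>++\<close> the right
      argument takes precedence, so \<open>k\<close> extends \<open>h\<close>.\<close>
    define k where "k = (\<lambda>p. if p \<in> FreeP_set \<Gamma> then Some c else None) ++ h"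
    have kh: "k p = h p" if "p \<in> dom h" for p
      using that by (auto simp: k_def map_add_def)
    have "dom k = FreeP_set \<Gamma> \<union> dom h" by (auto simp: k_def split: if_splits)
    then have k: "finite (dom k)" "FreeP_set \<Gamma>' \<union> FreeP_set \<Gamma> \<subseteq> dom k"
        "FreeP_set \<Gamma> \<union> FreeP \<gamma> \<subseteq> dom k"
      using h finite_FreeP_set wf by (auto simp: wf_ctx_def)
    have ran: "ran k \<subseteq> carr M"
      using c h(2) by (auto simp: k_def ran_def map_add_def split: option.splits if_splits)
    have "sat_par M k a" if "a \<in> \<Gamma>'" for a
    proof -
      have "sat_par M k a = sat_par M h a"
      proof (rule sat_par_cong)
        fix p assume "p \<in> FreeP a"
        then have "p \<in> dom h" using that h(3) by (auto simp: FreeP_set_def)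
        then show "k p = h p" by (rule kh)
      qed
      then show ?thesis using sat that by simp
    qed
    then have "\<forall>a \<in> \<Gamma>. sat_par M k a"
      using PS_ent_sound[OF PS_ent(3) wf PS_ent(1) PS_ent(2) M k(1,2) ran] by blast
    then have "ent_sat \<sigma> M \<phi> \<gamma> k" using PS_ent(4) M k ran by auto
    then show "ent_sat \<sigma> M \<phi> \<gamma> h"
    proof (rule ent_sat_team_cong[OF ne])
      show "sat M (tot k u) \<gamma> = sat M (tot h u) \<gamma>" for u
      proof (rule sat_tot_cong)
        fix p assume "p \<in> FreeP \<gamma>"
        then have "p \<in> dom h" using h(3) by auto
        then show "k p = h p" by (rule kh)
      qed
    qed (use k h in auto)
  qed
next
  case (PS_depar p \<gamma> gs \<Gamma> \<phi>)
  show ?case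
    unfolding valid_ext.simps
  proof (intro allI impI, elim conjE)
    fix M :: "('f, 'r, 'u) struct" and h
    assume M: "is_struct \<sigma> M" and h: "finite (dom h)" "ran h \<subseteq> carr M"
      "FreeP_set {Ex (Par p) (conjs gs)} \<union> FreeP \<gamma> \<subseteq> dom h"
      and sat: "\<forall>a \<in> {Ex (Par p) (conjs gs)}. sat_par M h a"
    have ne: "carr M \<noteq> {}" using M by (simp add: is_struct_def)
    from sat obtain c where c: "c \<in> carr M" "sat M ((join h Map.empty)(Par p \<mapsto> c)) (conjs gs)"
      by (auto simp: sat_par_def)
    have "(join h Map.empty)(Par p \<mapsto> c) = join (h(p \<mapsto> c)) Map.empty"
      by (auto simp: join_def fun_eq_iff split: var.split)
    then have "\<forall>a \<in> \<Gamma>. sat_par M (h(p \<mapsto> c)) a"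
      using c(2) PS_depar(2) by (simp add: sat_par_def sat_conjs)
    moreover have dom: "FreeP_set \<Gamma> \<union> FreeP \<gamma> \<subseteq> dom (h(p \<mapsto> c))"
      using h(3) PS_depar(2) by (auto simp: FreeP_set_simps FreeP_simps)
    moreover have "ran (h(p \<mapsto> c)) \<subseteq> carr M"
      using h(2) c by (auto simp: ran_def)
    ultimately have "ent_sat \<sigma> M \<phi> \<gamma> (h(p \<mapsto> c))"
      using PS_depar(5) M h(1) by auto
    \<comment> \<open>Even if the update replaces a value of \<open>h\<close>, the team of
      \<open>\<gamma>\<close> stays the same, because \<open>p\<close> is not free in it.\<close>
    moreover have "sat M (tot (h(p \<mapsto> c)) u) \<gamma> = sat M (tot h u) \<gamma>" for u
      by (rule sat_tot_cong) (use PS_depar(1) in auto)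
    ultimately show "ent_sat \<sigma> M \<phi> \<gamma> h"
      using ent_sat_team_cong[OF ne, of \<sigma> \<phi> \<gamma> "h(p \<mapsto> c)" h \<gamma>] dom h by auto
  qed
next
  case (PS_split gs1 \<Gamma>1 gs2 \<Gamma>2 \<gamma> \<phi>)
  then show ?case
    by (auto simp: FreeP_set_simps FreeP_simps sat_par_def sat_conjs)
qed

theorem mainTheorem1:
  fixes \<sigma> :: "('f, 'r) signature"
    and \<Gamma> :: "('f, 'r) fm set" and \<gamma> :: "('f, 'r) fm" and \<phi> :: "('f, 'r) ifm"
  assumes "infinite (UNIV :: 'e set)"
    and "provable TYPE('e) \<sigma> (\<Gamma>, \<gamma>, \<phi>)"
  shows "valid TYPE('u) \<sigma> (\<Gamma>, \<gamma>, \<phi>)"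
proof -
  obtain Ss where Ss: "is_proof TYPE('e) \<sigma> Ss" "Ss \<noteq> []" "last Ss = (\<Gamma>, \<gamma>, \<phi>)"
    using assms(2) by (auto simp: provable_def)
  \<comment> \<open>Premises stand at smaller positions. Both properties are proved together since
    \<open>infer_sound\<close> asks for well-formed premises.\<close>
  have step: "wf_seq \<sigma> (Ss ! i) \<and> valid_ext TYPE('u) \<sigma> (Ss ! i)" if "i < length Ss" for i
    using that
  proof (induction i rule: less_induct)
    case (less i)
    then obtain prems where p: "set prems \<subseteq> set (take i Ss)" "infer TYPE('e) \<sigma> prems (Ss ! i)"
      using Ss(1) by (auto simp: is_proof_def)
    have "wf_seq \<sigma> S \<and> valid_ext TYPE('u) \<sigma> S" if S: "S \<in> set prems" for S
    proof -
      have "S \<in> set (take i Ss)" using p(1) S by auto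
      then obtain j where "j < i" "S = Ss ! j" by (auto simp: in_set_conv_nth)
      then show ?thesis using less by auto
    qed
    then show ?case using infer_wf[OF p(2)] infer_sound[OF p(2) assms(1)] by blast
  qed
  have "(\<Gamma>, \<gamma>, \<phi>) = Ss ! (length Ss - 1)" using Ss by (simp add: last_conv_nth)
  moreover have "length Ss - 1 < length Ss" using Ss(2) by simp
  ultimately have "wf_seq \<sigma> (\<Gamma>, \<gamma>, \<phi>)" and v: "valid_ext TYPE('u) \<sigma> (\<Gamma>, \<gamma>, \<phi>)"
    using step by metis+
  then have wf: "wf_ctx \<sigma> \<Gamma>" by simp
  \<comment> \<open>This is the exact domain in \<open>valid\<close>; being finite, it is one of the
    domains that \<open>valid_ext\<close> covers.\<close>
  have "finite (FreeP_set \<Gamma> \<union> FreeP \<gamma>)"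
    using wf by (simp add: wf_ctx_def finite_FreeP_set finite_FreeP)
  then show ?thesis using v by auto
qed

end
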